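(* Let $X\neq\{0\}$ be a complex Banach space with norm $\|\cdot\|$ and open unit ball $\mathbb{B}=\{z\in X:\|z\|<1\}$. Let $f:\mathbb{B}\to\mathbb{C}$ be holomorphic with $f(0)=1$, and let $F:\mathbb{B}\to X$ be defined by $F(z)=z f(z)$. If $F\in\mathcal{S}^*(\mathbb{B})$ (that is, $F$ is a normalized starlike mapping on $\mathbb{B}$), then for every $z\in\mathbb{B}\setminus\{0\}$ and every $l_z\in T_z$, $$\left|(A_2-A_4)\left(A_2^2-2A_3^2+A_2A_4\right)\right|\le 84,$$ where $$A_2=\frac{l_z(D^2F(0)(z^2))}{2!\,\|z\|^2},\qquad A_3=\frac{l_z(D^3F(0)(z^3))}{3!\,\|z\|^3},\qquad A_4=\frac{l_z(D^4F(0)(z^4))}{4!\,\|z\|^4}.$$ Moreover, the estimate is sharp: for each such $X$, the constant $84$ cannot be replaced by any smaller constant valid for all such $f$, $z$ and $l_z$.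
   Context: For $z\in X\setminus\{0\}$, $T_z=\{l_z: X\to\mathbb{C} \text{ continuous linear}: l_z(z)=\|z\|,\ \|l_z\|=1\}$ (non-empty by Hahn–Banach). For a holomorphic mapping $F:\mathbb{B}\to X$, $D^kF(0)$ denotes the $k$-th Fréchet derivative of $F$ at $0$, a bounded symmetric $k$-linear mapping $X^k\to X$, and $D^kF(0)(z^k)=D^kF(0)(z,\dots,z)$ ($k$ times). A holomorphic $F:\mathbb{B}\to X$ is normalized if $F(0)=0$ and $DF(0)=I$, the identity operator on $X$. It is biholomorphic if its inverse exists and is holomorphic on the domain $F(\mathbb{B})$. A biholomorphic mapping $F$ on $\mathbb{B}$ is starlike if $F(\mathbb{B})$ is starlike with respect to the origin (i.e. $tw\in F(\mathbb{B})$ for all $w\in F(\mathbb{B})$, $t\in[0,1]$). $\mathcal{S}^*(\mathbb{B})$ is the class of normalized starlike (biholomorphic) mappings on $\mathbb{B}$. *)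

theory Defs
  imports "HOL-Analysis.Analysis"
begin

text \<open>
  Complex normed and complex Banach spaces. The real vector space structure (hence the norm
  topology, \<^const>\<open>has_derivative\<close>, etc.) is inherited from the library classes and is required
  to be the restriction of the complex scalar multiplication to real scalars.
\<close>

class complex_normed_vector = real_normed_vector +
  fixes scaleC :: "complex \<Rightarrow> 'a \<Rightarrow> 'a" (infixr "*\<^sub>C" 75)
  assumes scaleC_add_right: "c *\<^sub>C (x + y) = c *\<^sub>C x + c *\<^sub>C y"
    and scaleC_add_left: "(c + d) *\<^sub>C x = c *\<^sub>C x + d *\<^sub>C x"
    and scaleC_scaleC: "c *\<^sub>C d *\<^sub>C x = (c * d) *\<^sub>C x"
    and scaleC_one: "1 *\<^sub>C x = x"
    and scaleR_scaleC: "scaleR r x = complex_of_real r *\<^sub>C x"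
    and norm_scaleC: "norm (c *\<^sub>C x) = cmod c * norm x"

class complex_banach = complex_normed_vector + complete_space

subclass (in complex_banach) banach ..

instantiation complex :: complex_banach
begin

definition scaleC_complex_def: "c *\<^sub>C (z::complex) = c * z"

instance
  by standard (auto simp: scaleC_complex_def algebra_simps scaleR_conv_of_real norm_mult)

end

definition bounded_clinear ::
    "('a::complex_normed_vector \<Rightarrow> 'b::complex_normed_vector) \<Rightarrow> bool" where
  "bounded_clinear L \<longleftrightarrow> bounded_linear L \<and> (\<forall>c x. L (c *\<^sub>C x) = c *\<^sub>C L x)"

definition fholomorphic_on ::
    "('a::complex_normed_vector \<Rightarrow> 'b::complex_normed_vector) \<Rightarrow> 'a set \<Rightarrow> bool"
    (infixl "fholomorphic'_on" 50) where
  "F fholomorphic_on S \<longleftrightarrow>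
     open S \<and> (\<forall>z\<in>S. \<exists>L. bounded_clinear L \<and> (F has_derivative L) (at z))"

definition biholomorphic_on ::
    "('a::complex_normed_vector \<Rightarrow> 'b::complex_normed_vector) \<Rightarrow> 'a set \<Rightarrow> bool"
    (infixl "biholomorphic'_on" 50) where
  "F biholomorphic_on S \<longleftrightarrow>
     F fholomorphic_on S \<and> inj_on F S \<and> open (F ` S) \<and> connected (F ` S) \<and>
     inv_into S F fholomorphic_on (F ` S)"

definition normalized :: "('a::complex_normed_vector \<Rightarrow> 'a) \<Rightarrow> bool" where
  "normalized F \<longleftrightarrow> F 0 = 0 \<and> (F has_derivative (\<lambda>v. v)) (at 0)"

definition starlike_maps :: "('a::complex_normed_vector \<Rightarrow> 'a) set" where
  "starlike_maps = {F. F biholomorphic_on ball 0 1 \<and> normalized F \<and>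
     (\<forall>w\<in>F ` ball 0 1. \<forall>t\<in>{0..1::real}. t *\<^sub>R w \<in> F ` ball 0 1)}"

definition norming_functionals :: "'a::complex_normed_vector \<Rightarrow> ('a \<Rightarrow> complex) set" where
  "norming_functionals z =
     {l. bounded_clinear l \<and> l z = complex_of_real (norm z) \<and> onorm l = 1}"

text \<open>
  The Frechet derivative as a map into the space of bounded linear operators with the operator
  norm. It can be iterated, an element of \<open>'a \<Rightarrow>\<^sub>L ('a \<Rightarrow>\<^sub>L 'b)\<close> being a bounded bilinear map etc.
  Bounded linear operators in the library are real linear; for a holomorphic map the
  real Frechet derivative is also the complex one, by uniqueness of derivatives.
\<close>

definition fderiv ::
    "('a::real_normed_vector \<Rightarrow> 'b::real_normed_vector) \<Rightarrow> 'a \<Rightarrow> ('a \<Rightarrow>\<^sub>L 'b)" where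
  "fderiv F z = Blinfun (frechet_derivative F (at z))"

lemma fderiv_eqI: "(F has_derivative blinfun_apply L) (at z) \<Longrightarrow> fderiv F z = L"
  by (metis fderiv_def frechet_derivative_at blinfun_apply_inverse)

definition A2 :: "('a::complex_normed_vector \<Rightarrow> 'a) \<Rightarrow> 'a \<Rightarrow> ('a \<Rightarrow> complex) \<Rightarrow> complex" where
  "A2 F z l = l (fderiv (fderiv F) 0 z z) / complex_of_real (fact 2 * norm z ^ 2)"

definition A3 :: "('a::complex_normed_vector \<Rightarrow> 'a) \<Rightarrow> 'a \<Rightarrow> ('a \<Rightarrow> complex) \<Rightarrow> complex" where
  "A3 F z l = l (fderiv (fderiv (fderiv F)) 0 z z z) / complex_of_real (fact 3 * norm z ^ 3)"

definition A4 :: "('a::complex_normed_vector \<Rightarrow> 'a) \<Rightarrow> 'a \<Rightarrow> ('a \<Rightarrow> complex) \<Rightarrow> complex" where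
  "A4 F z l =
     l (fderiv (fderiv (fderiv (fderiv F))) 0 z z z z) / complex_of_real (fact 4 * norm z ^ 4)"

end

theory Submission
  imports Defs "HOL-Complex_Analysis.Complex_Analysis"
begin

text \<open>
  Put \<open>x = z / \<parallel>z\<parallel>\<close> and \<open>h(\<zeta>) = l(F(\<zeta> x))\<close>. Since \<open>F(\<zeta> x) = h(\<zeta>) x\<close> and any \<open>w\<close> for which \<open>F(w)\<close> is
  a nonzero multiple of \<open>x\<close> is itself a multiple of \<open>x\<close>, the function \<open>h\<close> is a normalized starlike function of the unit
  disc, and \<open>A\<^sub>k\<close> is its \<open>k\<close>-th Taylor coefficient. With \<open>p = \<zeta> h' / h\<close>, which has nonnegative real part
  and coefficients \<open>p\<^sub>k\<close>, comparing coefficients in \<open>p h = \<zeta> h'\<close> gives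
  \<open>2 A\<^sub>3\<^sup>2 - A\<^sub>2 A\<^sub>4 = p\<^sub>2\<^sup>2/2 + p\<^sub>1\<^sup>2 p\<^sub>2/6 + p\<^sub>1\<^sup>4/3 - p\<^sub>1 (p\<^sub>3 - p\<^sub>1 p\<^sub>2)/3\<close>. From \<open>\<bar>p\<^sub>k\<bar> \<le> 2\<close> and
  \<open>\<bar>p\<^sub>3 - p\<^sub>1 p\<^sub>2\<bar> \<le> 2\<close> this is at most 10 in modulus, so the second factor is at most 14, while the
  first is at most \<open>2 + 4\<close>. Equality holds for \<open>F(y) = y / (1 - \<i> l(y))\<^sup>2\<close>, where \<open>l\<close> is a norming
  functional.
\<close>

text \<open>The hypothesis supplies a single complex derivative, whereas \<open>A3\<close> and
  \<open>A4\<close> come from \<open>fderiv\<close> iterated into spaces of real linear operators.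
  The obstacle is therefore to show that these iterates really are derivatives. Holomorphy is tested
  by a set of functionals that recovers the norm; every scalar estimate depends only on a bound and
  a radius, so it is uniform over that set and passes back to the norm. Composing the functionals
  with evaluation at vectors of norm at most 1 repeats the argument for the derivative in place of
  the map. Hahn-Banach enters twice: it gives the first such set, and the functional in the extremal
  map. The constant is 84 = 6 * 14, a product of separate maxima. It is sharp because one function
  attains both. The Koebe function itself gives only 12; its rotation by \<open>\<i>\<close> changes
  the sign of the square of the second coefficient and makes the terms of each factor add
  up.\<close>

section \<open>The complex Hahn-Banach theorem\<close>

text \<open>By Zorn's lemma there is a minimal sublinear functional below a given one; minimality against
  the reduction \<open>q'(x) = inf\<^sub>t\<^sub>\<ge>\<^sub>0 (q(x + t y) - t q(y))\<close> makes it linear.\<close>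

definition sublinear :: "('a::real_vector \<Rightarrow> real) \<Rightarrow> bool" where
  "sublinear p \<longleftrightarrow> (\<forall>x y. p (x + y) \<le> p x + p y) \<and> (\<forall>t\<ge>0. \<forall>x. p (t *\<^sub>R x) = t * p x)"

text \<open>The inequality for t > 0 suffices: applied to 1/t and the vector t x it yields the
  reverse one.\<close>

lemma sublinearI:
  assumes add: "\<And>x y. p (x + y) \<le> p x + p y" and zero: "p 0 = 0"
    and scale: "\<And>t x. t > 0 \<Longrightarrow> p (t *\<^sub>R x) \<le> t * p x"
  shows "sublinear p"
  unfolding sublinear_def
proof (intro conjI allI impI)
  fix t :: real and x
  assume "t \<ge> 0"
  show "p (t *\<^sub>R x) = t * p x"
  proof (cases "t = 0")
    case False
    then have t: "t > 0" using \<open>t \<ge> 0\<close> by simp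
    have "p ((1/t) *\<^sub>R t *\<^sub>R x) \<le> (1/t) * p (t *\<^sub>R x)"
      using t by (intro scale) simp
    then have "t * p x \<le> p (t *\<^sub>R x)"
      using t by (simp add: field_simps)
    then show ?thesis using scale[OF t, of x] by simp
  qed (simp add: zero)
qed (rule add)

lemma
  assumes "sublinear p"
  shows sublinear_add: "p (x + y) \<le> p x + p y"
    and sublinear_scaleR: "t \<ge> 0 \<Longrightarrow> p (t *\<^sub>R x) = t * p x"
    and sublinear_zero: "p 0 = 0"
  using assms unfolding sublinear_def by (force, force, metis mult_zero_left order_refl scaleR_zero_left)

lemma sublinear_neg: "sublinear p \<Longrightarrow> - p (- x) \<le> p x"
  using sublinear_add[of p x "- x"] sublinear_zero[of p] by simp

lemma sublinear_norm: "sublinear (norm :: 'a::real_normed_vector \<Rightarrow> real)"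
  by (auto simp: sublinear_def norm_triangle_ineq)

lemma sublinear_reduce:
  assumes q: "sublinear q"
  obtains q' where "sublinear q'" "q' \<le> q" "q' (- y) \<le> - q y"
proof
  define g where "g x t = q (x + t *\<^sub>R y) - t * q y" for x t
  define q' where "q' x = (INF t\<in>{0..}. g x t)" for x
  have bdd: "bdd_below (g x ` {0..})" for x
  proof
    fix s assume "s \<in> g x ` {0..}"
    then obtain t where t: "t \<ge> 0" "s = g x t" by auto
    have "t * q y = q ((x + t *\<^sub>R y) + (- x))"
      using t q by (simp add: sublinear_scaleR)
    also have "\<dots> \<le> q (x + t *\<^sub>R y) + q (- x)"
      by (rule sublinear_add[OF q])
    finally show "- q (- x) \<le> s" using t by (simp add: g_def)
  qed
  have le: "q' x \<le> g x t" if "t \<ge> 0" for x t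
    unfolding q'_def using bdd that by (intro cINF_lower) auto
  have ge: "c \<le> q' x" if "\<And>t. t \<ge> 0 \<Longrightarrow> c \<le> g x t" for c x
    unfolding q'_def using that by (intro cINF_greatest) auto
  show "q' \<le> q"
    using le[of 0] by (auto simp: le_fun_def g_def)
  show "q' (- y) \<le> - q y"
    using le[of 1 "- y"] sublinear_zero[OF q] by (simp add: g_def)
  show "sublinear q'"
  proof (rule sublinearI)
    fix a b
    \<comment> \<open>The shift s + t is admissible for a + b, so \<open>q' (a + b)\<close> lies
      below every sum \<open>g a s + g b t\<close>. The two infima are then taken one after the
      other.\<close>
    have "q' (a + b) - q' b \<le> g a s" if s: "s \<ge> 0" for s
    proof -
      have "q' (a + b) - g a s \<le> g b t" if t: "t \<ge> 0" for t
      proof -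
        have "q' (a + b) \<le> g (a + b) (s + t)"
          using s t by (intro le) simp
        also have "q (a + b + (s + t) *\<^sub>R y) = q ((a + s *\<^sub>R y) + (b + t *\<^sub>R y))"
          by (simp add: algebra_simps)
        then have "g (a + b) (s + t) \<le> g a s + g b t"
          using sublinear_add[OF q, of "a + s *\<^sub>R y" "b + t *\<^sub>R y"]
          by (simp add: g_def algebra_simps)
        finally show ?thesis by simp
      qed
      from ge[OF this] show ?thesis by simp
    qed
    from ge[OF this] show "q' (a + b) \<le> q' a + q' b" by simp
  next
    have "g 0 t = 0" if "t \<ge> 0" for t
      using that q by (simp add: g_def sublinear_scaleR)
    then show "q' 0 = 0"
      using le[of 0 0] ge[of 0 0] by simp
  next
    fix t :: real and x assume t: "t > 0"
    have "q' (t *\<^sub>R x) / t \<le> g x s" if s: "s \<ge> 0" for s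
    proof -
      have "q' (t *\<^sub>R x) \<le> g (t *\<^sub>R x) (t * s)"
        using s t by (intro le) simp
      also have "\<dots> = t * g x s"
        using sublinear_scaleR[OF q, of t "x + s *\<^sub>R y"] t
        by (simp add: g_def algebra_simps)
      finally show ?thesis using t by (simp add: field_simps)
    qed
    from ge[OF this] show "q' (t *\<^sub>R x) \<le> t * q' x"
      using t by (simp add: field_simps)
  qed
qed

lemma linear_below_sublinear:
  fixes q :: "'a::real_vector \<Rightarrow> real"
  assumes q: "sublinear q"
  obtains m where "linear m" "\<And>x. m x \<le> q x"
proof -
  define A where "A = {p. sublinear p \<and> p \<le> q}"
  have "\<exists>m\<in>A. \<forall>a\<in>A. a \<le> m \<longrightarrow> a = m"
  proof (rule predicate_Zorn)
    \<comment> \<open>Zorn is applied to the reversed order: a chain then needs a lower bound in A,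
      and its pointwise infimum is one.\<close>
    show "partial_order_on A (relation_of (\<lambda>x y. y \<le> x) A)"
      by (rule partial_order_on_relation_ofI) auto
  next
    fix C assume C: "C \<in> Chains (relation_of (\<lambda>x y. y \<le> x) A)"
    then have CA: "C \<subseteq> A" and tot: "\<And>a b. a \<in> C \<Longrightarrow> b \<in> C \<Longrightarrow> a \<le> b \<or> b \<le> a"
      by (auto simp: Chains_def relation_of_def)
    show "\<exists>u\<in>A. \<forall>a\<in>C. u \<le> a"
    proof (cases "C = {}")
      case True
      then show ?thesis using q by (auto simp: A_def)
    next
      case False
      define u where "u x = (INF p\<in>C. p x)" for x
      have sub: "sublinear p" if "p \<in> C" for p using that CA by (auto simp: A_def)
      have bdd: "bdd_below ((\<lambda>p. p x) ` C)" for x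
      proof
        fix s assume "s \<in> (\<lambda>p. p x) ` C"
        then obtain p where p: "p \<in> C" "s = p x" by auto
        then have "p (- x) \<le> q (- x)" using CA by (auto simp: A_def le_fun_def)
        then show "- q (- x) \<le> s" using sublinear_neg[OF sub[OF p(1)], of x] p by simp
      qed
      have le: "u x \<le> p x" if "p \<in> C" for x p
        unfolding u_def using bdd that by (intro cINF_lower) auto
      have ge: "c \<le> u x" if "\<And>p. p \<in> C \<Longrightarrow> c \<le> p x" for c x
        unfolding u_def using that False by (intro cINF_greatest) auto
      have "sublinear u"
      proof (rule sublinearI)
        fix x y
        have "u (x + y) - u y \<le> p x" if p: "p \<in> C" for p
        proof -
          \<comment> \<open>Of two members of a chain the smaller one can be used at both x and
            y.\<close>
          have "u (x + y) - p x \<le> r y" if r: "r \<in> C" for r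
            using le[OF p, of "x + y"] le[OF r, of "x + y"] tot[OF p r]
              sublinear_add[OF sub[OF p], of x y] sublinear_add[OF sub[OF r], of x y]
            by (auto simp: le_fun_def) (smt (verit))+
          then show ?thesis using ge[of "u (x + y) - p x" y] by simp
        qed
        then show "u (x + y) \<le> u x + u y" using ge[of "u (x + y) - u y" x] by simp
      next
        show "u 0 = 0"
          using sublinear_zero[OF sub] False ge[of 0 0] le[of _ 0] by force
      next
        fix t :: real and x assume t: "t > 0"
        have "u (t *\<^sub>R x) / t \<le> p x" if "p \<in> C" for p
          using le[OF that, of "t *\<^sub>R x"] sublinear_scaleR[OF sub[OF that], of t x] t
          by (simp add: field_simps)
        from ge[OF this] show "u (t *\<^sub>R x) \<le> t * u x"
          using t by (simp add: field_simps)
      qed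
      moreover have "u \<le> q"
        using False le CA unfolding A_def le_fun_def by (smt (verit) equals0I mem_Collect_eq subsetD)
      ultimately show ?thesis
        using le by (auto simp: A_def le_fun_def)
    qed
  qed
  then obtain m where m: "sublinear m" "m \<le> q"
    and min: "\<And>p. sublinear p \<Longrightarrow> p \<le> m \<Longrightarrow> p = m"
    unfolding A_def by (metis (no_types, lifting) mem_Collect_eq order_trans)
  have neg: "m (- y) = - m y" for y
  proof -
    \<comment> \<open>Minimality makes m equal to its own reduction in the direction y, whence m(-y)
      <= -m(y); sublinearity gives the opposite inequality.\<close>
    obtain p where "sublinear p" "p \<le> m" "p (- y) \<le> - m y"
      by (rule sublinear_reduce[OF m(1)])
    then show ?thesis
      using min[of p] sublinear_neg[OF m(1), of "- y"] by simp
  qed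
  have add: "m (x + y) = m x + m y" for x y
    using sublinear_add[OF m(1), of "x + y" "- y"] sublinear_add[OF m(1), of x y] neg[of y] by simp
  have "m (t *\<^sub>R x) = t * m x" for t x
    using sublinear_scaleR[OF m(1), of t x] sublinear_scaleR[OF m(1), of "- t" x] neg[of "t *\<^sub>R x"]
    by (cases "t \<ge> 0") simp_all
  with add have "linear m" by (intro linearI) simp_all
  then show ?thesis using that m(2) by (auto simp: le_fun_def)
qed

text \<open>Reducing the norm in the direction x before passing to a linear functional forces u(-x)
  <= -norm x. This takes the place of an extension from the span of x.\<close>

lemma real_norming_functional:
  fixes x :: "'a::real_normed_vector"
  obtains u where "linear u" "u x = norm x" "\<And>y. u y \<le> norm y"
proof -
  obtain q :: "'a \<Rightarrow> real" where q: "sublinear q" "q \<le> norm" "q (- x) \<le> - norm x"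
    by (rule sublinear_reduce[OF sublinear_norm])
  obtain u where u: "linear u" "\<And>y. u y \<le> q y"
    using linear_below_sublinear[OF q(1)] by blast
  have le: "u y \<le> norm y" for y
    using u(2)[of y] q(2) by (auto simp: le_fun_def intro: order_trans)
  moreover have "u x = norm x"
    using u(2)[of "- x"] q(3) linear_neg[OF u(1), of x] le[of x] by simp
  ultimately show ?thesis using that u(1) by blast
qed

lemma norming_functional_bound:
  assumes "l \<in> norming_functionals z"
  shows "cmod (l x) \<le> norm x"
  using assms onorm[of l x] by (simp add: norming_functionals_def bounded_clinear_def)

lemma scaleC_scaleR_commute: "c *\<^sub>C (r *\<^sub>R x) = r *\<^sub>R (c *\<^sub>C x)"
  by (simp add: scaleR_scaleC scaleC_scaleC mult.commute)

text \<open>The complex linear functional with real part u is u(y) - i u(i y). Rotating y until its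
  value is a nonnegative real reduces the bound on the modulus to the bound on u. At z the modulus
  is then at most the real part, so the imaginary part vanishes.\<close>

theorem norming_functionals_nonempty:
  fixes z :: "'a::complex_normed_vector"
  assumes "z \<noteq> 0"
  shows "norming_functionals z \<noteq> {}"
proof -
  obtain u where u: "linear u" "u z = norm z" "\<And>y. u y \<le> norm y"
    using real_norming_functional[of z] by blast
  define l where "l y = Complex (u y) (- u (\<i> *\<^sub>C y))" for y
  have iR: "\<i> *\<^sub>C (r *\<^sub>R y) = r *\<^sub>R (\<i> *\<^sub>C y)" for r and y :: 'a
    by (rule scaleC_scaleR_commute)
  have ii: "\<i> *\<^sub>C \<i> *\<^sub>C y = - y" for y :: 'a
    using scaleR_scaleC[of "-1" y] by (simp add: scaleC_scaleC)
  have add: "l (x + y) = l x + l y" for x y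
    by (simp add: l_def scaleC_add_right linear_add[OF u(1)] complex_eq_iff)
  have lR: "l (r *\<^sub>R y) = r *\<^sub>R l y" for r y
    by (simp add: l_def iR linear_cmul[OF u(1)] complex_eq_iff)
  have li: "l (\<i> *\<^sub>C y) = \<i> * l y" for y
    by (simp add: l_def ii linear_neg[OF u(1)] complex_eq_iff)
  have lC: "l (c *\<^sub>C y) = c * l y" for c y
  proof -
    have "c *\<^sub>C y = (of_real (Re c) + of_real (Im c) * \<i>) *\<^sub>C y"
      by (metis complex_eq mult.commute)
    also have "\<dots> = Re c *\<^sub>R y + Im c *\<^sub>R (\<i> *\<^sub>C y)"
      by (simp add: scaleR_scaleC scaleC_add_left scaleC_scaleC)
    also have "l \<dots> = of_real (Re c) * l y + of_real (Im c) * (\<i> * l y)"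
      by (simp add: add lR li scaleR_conv_of_real)
    also have "\<dots> = (of_real (Re c) + \<i> * of_real (Im c)) * l y"
      by (simp add: algebra_simps)
    finally show ?thesis by (simp flip: complex_eq)
  qed
  have bound: "cmod (l y) \<le> norm y" for y
  proof (cases "l y = 0")
    case False
    define c where "c = cnj (l y) / of_real (cmod (l y))"
    have "cmod c = 1" using False by (simp add: c_def norm_divide)
    have "c * l y = of_real (cmod (l y))"
      using False by (simp add: c_def mult.commute[of "cnj _"] complex_norm_square[symmetric] power2_eq_square)
    then have "cmod (l y) = Re (l (c *\<^sub>C y))" by (simp add: lC)
    also have "\<dots> = u (c *\<^sub>C y)" by (simp add: l_def)
    also have "\<dots> \<le> norm (c *\<^sub>C y)" by (rule u(3))
    also have "\<dots> = norm y" using \<open>cmod c = 1\<close> by (simp add: norm_scaleC)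
    finally show ?thesis .
  qed simp
  have bl: "bounded_linear l"
    by (rule bounded_linear_intro[where K = 1]) (simp_all add: add lR bound)
  have lz: "l z = of_real (norm z)"
  proof -
    have "Re (l z) = norm z" using u(2) by (simp add: l_def)
    moreover have "(cmod (l z))\<^sup>2 = (Re (l z))\<^sup>2 + (Im (l z))\<^sup>2" by (rule cmod_power2)
    moreover have "(cmod (l z))\<^sup>2 \<le> (norm z)\<^sup>2" using bound by (intro power_mono) auto
    ultimately have "Im (l z) = 0" by simp
    then show ?thesis using \<open>Re (l z) = norm z\<close> by (simp add: complex_eq_iff)
  qed
  have "onorm l = 1"
  proof (rule antisym)
    show "onorm l \<le> 1" by (rule onorm_bound) (simp_all add: bound)
    show "1 \<le> onorm l" using le_onorm[OF bl, of z] assms by (simp add: lz)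
  qed
  then show ?thesis
    using bl lz lC by (auto simp: norming_functionals_def bounded_clinear_def scaleC_complex_def)
qed

section \<open>Directional derivatives of bounded scalar functions\<close>

text \<open>Discs of radius R/4 around points of the half-size disc stay inside the domain, so
  Cauchy's inequality bounds the second derivative by 2 M / (R/4)^2, which is 32 M / R^2. The Taylor
  estimate used divides by \<open>fact 1\<close>, so the 32 is not halved.\<close>

lemma second_order_remainder_le:
  assumes hol: "g holomorphic_on ball 0 R" and bd: "\<And>z. z \<in> ball 0 R \<Longrightarrow> cmod (g z) \<le> M"
    and R: "R > 0" and z: "cmod z \<le> R / 2"
  shows "cmod (g z - g 0 - deriv g 0 * z) \<le> 32 * M / R\<^sup>2 * (cmod z)\<^sup>2"
proof -
  have sub: "cball w (R / 4) \<subseteq> ball 0 R" if "w \<in> cball 0 (R / 2)" for w :: complex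
    using that R by (intro subsetI) (auto simp: dist_norm, smt (verit) norm_triangle_sub norm_minus_commute field_sum_of_halves)
  have der: "((deriv ^^ i) g has_field_derivative (deriv ^^ Suc i) g w) (at w within cball 0 (R / 2))"
    if "w \<in> cball 0 (R / 2)" for i w
  proof -
    have "w \<in> ball 0 R" using that R by auto
    then have "(deriv ^^ i) g field_differentiable at w"
      using holomorphic_higher_deriv[OF hol, of i] by (auto simp: holomorphic_on_open field_differentiable_def)
    then show ?thesis
      by (simp add: DERIV_deriv_iff_field_differentiable has_field_derivative_at_within)
  qed
  have "cmod (g z - (\<Sum>i\<le>1. (deriv ^^ i) g 0 * (z - 0) ^ i / fact i))
      \<le> (32 * M / R\<^sup>2) * cmod (z - 0) ^ Suc 1 / fact 1"
  proof (rule complex_Taylor[where f = "\<lambda>i. (deriv ^^ i) g" and n = 1 and S = "cball 0 (R/2)", simplified funpow_0])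
    fix w :: complex assume w: "w \<in> cball 0 (R / 2)"
    have "cmod ((deriv ^^ 2) g w) \<le> fact 2 * M / (R / 4) ^ 2"
    proof (rule Cauchy_inequality)
      show "g holomorphic_on ball w (R / 4)" "continuous_on (cball w (R / 4)) g"
        using sub[OF w] ball_subset_cball[of w "R / 4"]
        by (blast intro: holomorphic_on_imp_continuous_on holomorphic_on_subset[OF hol])+
      show "cmod (g x) \<le> M" if "cmod (w - x) = R / 4" for x
        using sub[OF w] that by (intro bd) (auto simp: dist_norm)
    qed (use R in auto)
    then show "cmod ((deriv ^^ Suc 1) g w) \<le> 32 * M / R\<^sup>2"
      by (simp add: power2_eq_square numeral_2_eq_2)
  qed (use der z R in auto)
  then show ?thesis by (simp add: power2_eq_square algebra_simps)
qed

definition gateaux_holomorphic_on :: "('a::complex_normed_vector \<Rightarrow> complex) \<Rightarrow> 'a set \<Rightarrow> bool" where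
  "gateaux_holomorphic_on g S \<longleftrightarrow>
     (\<forall>x v. (\<lambda>\<zeta>. g (x + \<zeta> *\<^sub>C v)) holomorphic_on {\<zeta>. x + \<zeta> *\<^sub>C v \<in> S})"

definition dir_deriv :: "('a::complex_normed_vector \<Rightarrow> complex) \<Rightarrow> 'a \<Rightarrow> 'a \<Rightarrow> complex" where
  "dir_deriv g x v = deriv (\<lambda>\<zeta>. g (x + \<zeta> *\<^sub>C v)) 0"

lemma scaleC_zero_left [simp]: "0 *\<^sub>C x = (0 :: 'a::complex_normed_vector)"
  using norm_scaleC[of 0 x] by simp

lemma scaleC_zero_right [simp]: "c *\<^sub>C 0 = (0 :: 'a::complex_normed_vector)"
  using norm_scaleC[of c "0::'a"] by simp

lemma dir_deriv_zero: "dir_deriv g x 0 = 0"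
  by (simp add: dir_deriv_def)

lemma bounded_linear_scaleC_left: "bounded_linear (\<lambda>c. c *\<^sub>C (x::'a::complex_normed_vector))"
  by (rule bounded_linear_intro[where K = "norm x"])
     (simp_all add: scaleC_add_left scaleR_scaleC[where 'a = 'a] scaleC_scaleC norm_scaleC scaleR_conv_of_real)

lemma open_complex_line_preimage:
  assumes "open S"
  shows "open {\<zeta>. x + \<zeta> *\<^sub>C (v::'a::complex_normed_vector) \<in> S}"
proof -
  have "continuous_on UNIV (\<lambda>\<zeta>. x + \<zeta> *\<^sub>C v)"
    by (intro continuous_intros bounded_linear.continuous_on[OF bounded_linear_scaleC_left])
  from open_vimage[OF assms this] show ?thesis by (simp add: vimage_def)
qed

context
  fixes g :: "'a::complex_normed_vector \<Rightarrow> complex" and r M :: real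
  assumes hol: "gateaux_holomorphic_on g (ball 0 r)"
    and bd: "\<And>x. norm x < r \<Longrightarrow> cmod (g x) \<le> M"
    and r: "r > 0"
begin

lemma line_holomorphic:
  assumes "norm x < r / 2" "v \<noteq> 0"
  shows "(\<lambda>\<zeta>. g (x + \<zeta> *\<^sub>C v)) holomorphic_on ball 0 (r / (2 * norm v))"
    and "\<zeta> \<in> ball 0 (r / (2 * norm v)) \<Longrightarrow> cmod (g (x + \<zeta> *\<^sub>C v)) \<le> M"
proof -
  have *: "norm (x + \<zeta> *\<^sub>C v) < r" if "\<zeta> \<in> ball 0 (r / (2 * norm v))" for \<zeta>
  proof -
    have "norm (\<zeta> *\<^sub>C v) < r / 2"
      using that assms by (simp add: norm_scaleC field_simps)
    then show ?thesis using norm_triangle_ineq[of x "\<zeta> *\<^sub>C v"] assms by simp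
  qed
  then show "(\<lambda>\<zeta>. g (x + \<zeta> *\<^sub>C v)) holomorphic_on ball 0 (r / (2 * norm v))"
    using hol unfolding gateaux_holomorphic_on_def
    by (auto intro: holomorphic_on_subset[of _ "{\<zeta>. x + \<zeta> *\<^sub>C v \<in> ball 0 r}"])
  show "cmod (g (x + \<zeta> *\<^sub>C v)) \<le> M" if "\<zeta> \<in> ball 0 (r / (2 * norm v))"
    by (intro bd * that)
qed

text \<open>The scalar remainder bound is used at parameter 1 on the line through x in the direction
  h, with R = r / (2 norm h); norm h <= r/4 puts 1 within R/2, and 32 / R^2 produces the 128. The
  function enters only through M and r, which makes the bound uniform over functionals.\<close>

lemma dir_deriv_remainder:
  assumes x: "norm x < r / 2" and h: "norm h \<le> r / 4"
  shows "cmod (g (x + h) - g x - dir_deriv g x h) \<le> 128 * M / r\<^sup>2 * (norm h)\<^sup>2"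
proof (cases "h = 0")
  case False
  define R where "R = r / (2 * norm h)"
  have "2 \<le> R" using h False by (simp add: R_def field_simps)
  have "cmod (g (x + 1 *\<^sub>C h) - g (x + 0 *\<^sub>C h) - deriv (\<lambda>\<zeta>. g (x + \<zeta> *\<^sub>C h)) 0 * 1)
      \<le> 32 * M / R\<^sup>2 * (cmod 1)\<^sup>2"
    using \<open>2 \<le> R\<close> line_holomorphic[OF x False]
    by (intro second_order_remainder_le) (auto simp: R_def)
  also have "32 * M / R\<^sup>2 * (cmod 1)\<^sup>2 = 128 * M / r\<^sup>2 * (norm h)\<^sup>2"
    using False r by (simp add: R_def field_simps)
  finally show ?thesis by (simp add: dir_deriv_def scaleC_one)
qed (simp add: dir_deriv_zero)

lemma dir_deriv_bound:
  assumes x: "norm x < r / 2"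
  shows "cmod (dir_deriv g x v) \<le> 4 * M / r * norm v"
proof (cases "v = 0")
  case False
  define R where "R = r / (2 * norm v)"
  have "R > 0" using r False by (simp add: R_def)
  then have sub: "cball 0 (R / 2) \<subseteq> ball (0::complex) R" by auto
  have "cmod ((deriv ^^ 1) (\<lambda>\<zeta>. g (x + \<zeta> *\<^sub>C v)) 0) \<le> fact 1 * M / (R / 2) ^ 1"
  proof (rule Cauchy_inequality)
    show "(\<lambda>\<zeta>. g (x + \<zeta> *\<^sub>C v)) holomorphic_on ball 0 (R / 2)"
      using line_holomorphic(1)[OF x False] \<open>R > 0\<close>
      by (rule_tac holomorphic_on_subset) (auto simp: R_def)
    show "continuous_on (cball 0 (R / 2)) (\<lambda>\<zeta>. g (x + \<zeta> *\<^sub>C v))"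
      using line_holomorphic(1)[OF x False] sub unfolding R_def
      by (blast intro: holomorphic_on_imp_continuous_on holomorphic_on_subset)
    show "cmod (g (x + \<zeta> *\<^sub>C v)) \<le> M" if "cmod (0 - \<zeta>) = R / 2" for \<zeta>
      using \<open>R > 0\<close> that by (intro line_holomorphic(2)[OF x False]) (auto simp: R_def)
  qed (use \<open>R > 0\<close> in auto)
  then show ?thesis
    using r False by (simp add: R_def dir_deriv_def field_simps)
qed (simp add: dir_deriv_zero)

lemma dir_deriv_scaleC:
  assumes x: "norm x < r"
  shows "dir_deriv g x (c *\<^sub>C v) = c * dir_deriv g x v"
proof -
  let ?f = "\<lambda>\<zeta>. g (x + \<zeta> *\<^sub>C v)"
  have "?f field_differentiable at 0"
    using hol x open_complex_line_preimage[OF open_ball, of x v 0 r]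
    unfolding gateaux_holomorphic_on_def
    by (intro holomorphic_on_imp_differentiable_at[of _ "{\<zeta>. x + \<zeta> *\<^sub>C v \<in> ball 0 r}"]) auto
  then have "deriv (?f \<circ> (\<lambda>\<zeta>. c * \<zeta>)) 0 = deriv ?f (c * 0) * deriv (\<lambda>\<zeta>. c * \<zeta>) 0"
    by (intro deriv_chain) (auto intro!: derivative_intros)
  then show ?thesis
    by (simp add: dir_deriv_def o_def scaleC_scaleC mult.commute)
qed

text \<open>A rate of convergence that is uniform in x serves two purposes: holomorphic dependence
  on x, and a Cauchy sequence of vector-valued quotients.\<close>

lemma dir_deriv_quotient:
  assumes x: "norm x < r / 2" and n: "n > 0" "norm v \<le> r / 4 * real n"
  shows "cmod (of_nat n * (g (x + (1 / real n) *\<^sub>R v) - g x) - dir_deriv g x v)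
           \<le> 128 * M / r\<^sup>2 * (norm v)\<^sup>2 / real n"
proof -
  let ?h = "(1 / real n) *\<^sub>R v"
  have "cmod (g (x + ?h) - g x - dir_deriv g x ?h) \<le> 128 * M / r\<^sup>2 * (norm ?h)\<^sup>2"
    using n by (intro dir_deriv_remainder[OF x]) (simp add: field_simps)
  moreover have "dir_deriv g x ?h = dir_deriv g x v / of_nat n"
    using dir_deriv_scaleC[of x "of_real (1 / real n)" v] x r by (simp add: scaleR_scaleC)
  ultimately have "real n * cmod (g (x + ?h) - g x - dir_deriv g x v / of_nat n)
      \<le> real n * (128 * M / r\<^sup>2 * (norm ?h)\<^sup>2)"
    by (intro mult_left_mono) auto
  also have "real n * cmod (g (x + ?h) - g x - dir_deriv g x v / of_nat n)
      = cmod (of_nat n * (g (x + ?h) - g x - dir_deriv g x v / of_nat n))"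
    by (simp add: norm_mult)
  also have "of_nat n * (g (x + ?h) - g x - dir_deriv g x v / of_nat n)
      = of_nat n * (g (x + ?h) - g x) - dir_deriv g x v"
    using n by (simp add: field_simps)
  finally show ?thesis
    using n by (simp add: field_simps power2_eq_square)
qed

text \<open>The directional derivative is a locally uniform limit of difference quotients, each
  holomorphic along the line. The radius is halved to leave room for the increments of the
  quotients.\<close>

lemma dir_deriv_holomorphic:
  "(\<lambda>\<zeta>. dir_deriv g (x + \<zeta> *\<^sub>C u) v) holomorphic_on {\<zeta>. x + \<zeta> *\<^sub>C u \<in> ball 0 (r / 2)}"
    (is "_ holomorphic_on ?S")
proof -
  \<comment> \<open>Starting the sequence at n0 keeps the norm of v / N k at most r/4, so every
    quotient is defined on all of \<open>?S\<close>.\<close>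
  obtain n0 :: nat where n0: "n0 > 0" "norm v \<le> r / 4 * real n0"
  proof -
    obtain n :: nat where "norm v / (r / 4) < real n" using reals_Archimedean2 by blast
    then show ?thesis using r
      by (intro that[of "Suc n"]) (auto simp: field_simps intro: order_trans)
  qed
  define N where "N k = k + n0" for k
  have N: "N k > 0" "norm v \<le> r / 4 * real (N k)" for k
    using n0 r by (auto simp: N_def algebra_simps intro: order_trans)
  let ?K = "128 * M / r\<^sup>2 * (norm v)\<^sup>2"
  let ?f = "\<lambda>k \<zeta>. of_nat (N k) * (g (x + \<zeta> *\<^sub>C u + (1 / real (N k)) *\<^sub>R v) - g (x + \<zeta> *\<^sub>C u))"
  have opn: "open ?S" by (rule open_complex_line_preimage) simp
  show ?thesis
  proof (rule holomorphic_uniform_sequence[OF opn, where f = ?f])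
    fix k
    let ?w = "(1 / real (N k)) *\<^sub>R v"
    have w: "norm ?w \<le> r / 4" using N[of k] by (simp add: field_simps)
    have tri: "norm (a + b) < r" if "norm a < r / 2" "norm b \<le> r / 4" for a b :: 'a
      using norm_triangle_ineq[of a b] that r by linarith
    have "(\<lambda>\<zeta>. g ((x + ?w) + \<zeta> *\<^sub>C u)) holomorphic_on ?S"
    proof (rule holomorphic_on_subset)
      show "(\<lambda>\<zeta>. g ((x + ?w) + \<zeta> *\<^sub>C u)) holomorphic_on {\<zeta>. (x + ?w) + \<zeta> *\<^sub>C u \<in> ball 0 r}"
        using hol unfolding gateaux_holomorphic_on_def by blast
      have "norm (x + ?w + \<zeta> *\<^sub>C u) < r" if "norm (x + \<zeta> *\<^sub>C u) < r / 2" for \<zeta>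
      proof -
        have eq: "x + ?w + \<zeta> *\<^sub>C u = (x + \<zeta> *\<^sub>C u) + ?w" by simp
        show ?thesis unfolding eq by (rule tri[OF that w])
      qed
      then show "?S \<subseteq> {\<zeta>. (x + ?w) + \<zeta> *\<^sub>C u \<in> ball 0 r}" by auto
    qed
    moreover have "(\<lambda>\<zeta>. g (x + \<zeta> *\<^sub>C u)) holomorphic_on ?S"
      using hol r unfolding gateaux_holomorphic_on_def
      by (auto intro: holomorphic_on_subset[of _ "{\<zeta>. x + \<zeta> *\<^sub>C u \<in> ball 0 r}"])
    ultimately show "?f k holomorphic_on ?S"
      by (intro holomorphic_intros) (simp_all add: algebra_simps)
  next
    fix \<zeta> assume "\<zeta> \<in> ?S"
    then obtain d where d: "d > 0" "cball \<zeta> d \<subseteq> ?S" using opn open_contains_cball by blast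
    have "uniform_limit (cball \<zeta> d) ?f (\<lambda>\<zeta>. dir_deriv g (x + \<zeta> *\<^sub>C u) v) sequentially"
    proof (rule uniform_limitI)
      fix e :: real assume "e > 0"
      have "(\<lambda>k. ?K / real (k + n0)) \<longlonglongrightarrow> 0"
        by (rule LIMSEQ_ignore_initial_segment[OF lim_const_over_n])
      then have "\<forall>\<^sub>F k in sequentially. ?K / real (N k) < e"
        using \<open>e > 0\<close> unfolding N_def by (rule order_tendstoD)
      then show "\<forall>\<^sub>F k in sequentially. \<forall>\<zeta>\<in>cball \<zeta> d. dist (?f k \<zeta>) (dir_deriv g (x + \<zeta> *\<^sub>C u) v) < e"
      proof eventually_elim
        case (elim k)
        show ?case
        proof
          fix w assume "w \<in> cball \<zeta> d"
          then have "norm (x + w *\<^sub>C u) < r / 2" using d by auto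
          from le_less_trans[OF dir_deriv_quotient[OF this N] elim]
          show "dist (?f k w) (dir_deriv g (x + w *\<^sub>C u) v) < e" by (simp only: dist_norm)
        qed
      qed
    qed
    with d show "\<exists>d>0. cball \<zeta> d \<subseteq> ?S \<and>
        uniform_limit (cball \<zeta> d) ?f (\<lambda>\<zeta>. dir_deriv g (x + \<zeta> *\<^sub>C u) v) sequentially"
      by blast
  qed
qed

text \<open>The increment from x to x + t(u + v) is split at x + t u, each remainder being of order
  t^2. The derivative in the direction v is thus taken at x + t u; it tends to the one at x by
  continuity along the line, which \<open>dir_deriv_holomorphic\<close> provides.\<close>

lemma dir_deriv_add:
  assumes x: "norm x < r / 2"
  shows "dir_deriv g x (u + v) = dir_deriv g x u + dir_deriv g x v"
proof -
  let ?K = "128 * M / r\<^sup>2"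
  let ?E = "dir_deriv g x (u + v) - dir_deriv g x u"
  let ?C = "?K * (norm (u + v))\<^sup>2 + ?K * (norm u)\<^sup>2 + ?K * (norm v)\<^sup>2"
  let ?D = "\<lambda>t::real. dir_deriv g (x + of_real t *\<^sub>C u) v"
  have "continuous_on {\<zeta>. x + \<zeta> *\<^sub>C u \<in> ball 0 (r / 2)} (\<lambda>\<zeta>. dir_deriv g (x + \<zeta> *\<^sub>C u) v)"
    by (intro holomorphic_on_imp_continuous_on dir_deriv_holomorphic)
  then have "isCont (\<lambda>\<zeta>. dir_deriv g (x + \<zeta> *\<^sub>C u) v) (complex_of_real 0)"
    using x by (subst (asm) continuous_on_eq_continuous_at[OF open_complex_line_preimage[OF open_ball]]) auto
  then have "isCont ?D 0"
    by (intro isCont_o2[where g = "\<lambda>\<zeta>. dir_deriv g (x + \<zeta> *\<^sub>C u) v" and f = complex_of_real])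
       (auto intro!: continuous_intros)
  then have "(?D \<longlongrightarrow> dir_deriv g x v) (at_right 0)"
    using continuous_at_imp_continuous_at_within[of 0 ?D "{0<..}"] by (simp add: continuous_within)
  then have lim: "((\<lambda>t. ?E - ?D t) \<longlongrightarrow> ?E - dir_deriv g x v) (at_right 0)"
    by (intro tendsto_intros)
  have small: "\<forall>\<^sub>F t in at_right 0. t * a \<le> r / 4" for a
  proof -
    have "((\<lambda>t. t * a) \<longlongrightarrow> 0 * a) (at_right 0)" by (intro tendsto_intros)
    then have "\<forall>\<^sub>F t in at_right 0. t * a < r / 4" using r by (intro order_tendstoD) auto
    then show ?thesis by eventually_elim simp
  qed
  have near: "\<forall>\<^sub>F t in at_right 0. norm x + t * norm u < r / 2"
  proof -
    have "((\<lambda>t. norm x + t * norm u) \<longlongrightarrow> norm x + 0 * norm u) (at_right 0)" by (intro tendsto_intros)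
    then show ?thesis using x by (intro order_tendstoD) auto
  qed
  have bound: "\<forall>\<^sub>F t in at_right 0. norm (?E - ?D t) \<le> ?C * t"
    using small[of "norm (u + v)"] small[of "norm u"] small[of "norm v"] near eventually_at_right_less
  proof eventually_elim
    case (elim t)
    have y: "norm (x + t *\<^sub>R u) < r / 2"
      using elim norm_triangle_ineq[of x "t *\<^sub>R u"] by simp
    have sc: "dir_deriv g z (t *\<^sub>R w) = of_real t * dir_deriv g z w" if "norm z < r / 2" for z w
      using dir_deriv_scaleC[of z "of_real t" w] that r by (simp flip: scaleR_scaleC)
    have 1: "cmod (g (x + t *\<^sub>R (u + v)) - g x - of_real t * dir_deriv g x (u + v)) \<le> ?K * (t * norm (u + v))\<^sup>2"
      using dir_deriv_remainder[OF x, of "t *\<^sub>R (u + v)"] elim sc[OF x] by simp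
    have 2: "cmod (g (x + t *\<^sub>R u) - g x - of_real t * dir_deriv g x u) \<le> ?K * (t * norm u)\<^sup>2"
      using dir_deriv_remainder[OF x, of "t *\<^sub>R u"] elim sc[OF x] by simp
    have 3: "cmod (g (x + t *\<^sub>R (u + v)) - g (x + t *\<^sub>R u) - of_real t * ?D t) \<le> ?K * (t * norm v)\<^sup>2"
      using dir_deriv_remainder[OF y, of "t *\<^sub>R v"] elim sc[OF y]
      by (simp add: scaleR_right_distrib add.assoc flip: scaleR_scaleC)
    have tri: "cmod (b + c - a) \<le> A + B + C"
      if "cmod a \<le> A" "cmod b \<le> B" "cmod c \<le> C" for a b c A B C
      using that norm_triangle_ineq4[of "b + c" a] norm_triangle_ineq[of b c] by linarith
    have "t * cmod (?E - ?D t) = cmod (of_real t * (?E - ?D t))"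
      using elim(5) by (simp only: norm_mult norm_of_real abs_of_pos)
    also have "\<dots> \<le> t * (?C * t)"
      using tri[OF 1 2 3] by (simp add: algebra_simps power2_eq_square)
    finally show ?case by (rule mult_left_le_imp_le) (rule elim(5))
  qed
  have "((\<lambda>t. ?C * t) \<longlongrightarrow> 0) (at_right 0)"
    by (intro tendsto_mult_right_zero tendsto_ident_at)
  with bound have "((\<lambda>t. ?E - ?D t) \<longlongrightarrow> 0) (at_right 0)"
    by (rule Lim_null_comparison)
  with lim have "?E - dir_deriv g x v = 0"
    by (intro tendsto_unique[OF _ lim]) auto
  then show ?thesis by (simp add: algebra_simps)
qed

end

section \<open>Frechet differentiability from norming functionals\<close>

text \<open>The functionals are complex-valued but only real linear, since the target may be a space
  of real linear operators; holomorphy is seen through their values. The second clause lets a bound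
  common to all functionals become a bound in norm.\<close>

definition norming_set :: "('b::real_normed_vector \<Rightarrow> complex) set \<Rightarrow> bool" where
  "norming_set \<Phi> \<longleftrightarrow>
     (\<forall>\<phi>\<in>\<Phi>. bounded_linear \<phi> \<and> (\<forall>y. cmod (\<phi> y) \<le> norm y)) \<and>
     (\<forall>y B. (\<forall>\<phi>\<in>\<Phi>. cmod (\<phi> y) \<le> B) \<longrightarrow> norm y \<le> B)"

lemma
  assumes "norming_set \<Phi>"
  shows norming_set_linear: "\<phi> \<in> \<Phi> \<Longrightarrow> bounded_linear \<phi>"
    and norming_set_le: "\<phi> \<in> \<Phi> \<Longrightarrow> cmod (\<phi> y) \<le> norm y"
    and norming_set_bound: "(\<And>\<phi>. \<phi> \<in> \<Phi> \<Longrightarrow> cmod (\<phi> y) \<le> B) \<Longrightarrow> norm y \<le> B"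
  using assms unfolding norming_set_def by blast+

lemma norming_set_eqI:
  assumes "norming_set \<Phi>" and eq: "\<And>\<phi>. \<phi> \<in> \<Phi> \<Longrightarrow> \<phi> x = \<phi> y"
  shows "x = y"
proof -
  have "norm (x - y) \<le> 0"
    using assms(1) norming_set_linear[OF assms(1)] eq
    by (intro norming_set_bound[OF assms(1)]) (simp add: linear_diff bounded_linear.linear)
  then show ?thesis by simp
qed

definition weakly_holomorphic ::
    "('b::real_normed_vector \<Rightarrow> complex) set \<Rightarrow> real \<Rightarrow> ('a::complex_normed_vector \<Rightarrow> 'b) \<Rightarrow> bool" where
  "weakly_holomorphic \<Phi> r G \<longleftrightarrow>
     (\<exists>M. \<forall>x. norm x < r \<longrightarrow> norm (G x) \<le> M) \<and>
     (\<forall>\<phi>\<in>\<Phi>. gateaux_holomorphic_on (\<lambda>x. \<phi> (G x)) (ball 0 r))"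

text \<open>On \<open>fderiv G\<close> these functionals take directional derivatives of the
  functions obtained from G by the old functionals, so the scalar results apply to them
  again.\<close>

definition lift_functionals ::
    "('b::real_normed_vector \<Rightarrow> complex) set \<Rightarrow> (('a::real_normed_vector \<Rightarrow>\<^sub>L 'b) \<Rightarrow> complex) set" where
  "lift_functionals \<Phi> = {\<lambda>T. \<phi> (blinfun_apply T v) | \<phi> v. \<phi> \<in> \<Phi> \<and> norm v \<le> 1}"

lemma norming_set_lift:
  assumes "norming_set \<Phi>"
  shows "norming_set (lift_functionals \<Phi> :: (('a::real_normed_vector \<Rightarrow>\<^sub>L 'b::real_normed_vector) \<Rightarrow> complex) set)"
  unfolding norming_set_def
proof (intro conjI ballI allI impI)
  fix \<psi> :: "('a \<Rightarrow>\<^sub>L 'b) \<Rightarrow> complex" assume "\<psi> \<in> lift_functionals \<Phi>"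
  then obtain \<phi> v where \<psi>: "\<psi> = (\<lambda>T. \<phi> (blinfun_apply T v))" "\<phi> \<in> \<Phi>" "norm v \<le> 1"
    by (auto simp: lift_functionals_def)
  show "bounded_linear \<psi>"
    unfolding \<psi>(1) using norming_set_linear[OF assms \<psi>(2)]
    by (rule bounded_linear_compose) (rule blinfun.bounded_linear_left)
  show "cmod (\<psi> T) \<le> norm T" for T
  proof -
    have "cmod (\<psi> T) \<le> norm (blinfun_apply T v)" unfolding \<psi>(1) by (rule norming_set_le[OF assms \<psi>(2)])
    also have "\<dots> \<le> norm T * norm v" by (rule norm_blinfun)
    also have "\<dots> \<le> norm T" using \<psi>(3) by (simp add: mult_left_le)
    finally show ?thesis .
  qed
next
  fix T :: "'a \<Rightarrow>\<^sub>L 'b" and B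
  assume B: "\<forall>\<psi>\<in>lift_functionals \<Phi>. cmod (\<psi> T) \<le> B"
  have unit: "norm (blinfun_apply T v) \<le> B" if "norm v \<le> 1" for v
    using that B by (intro norming_set_bound[OF assms]) (auto simp: lift_functionals_def)
  show "norm T \<le> B"
  proof (rule norm_blinfun_bound)
    show "0 \<le> B" using unit[of 0] by simp
    show "norm (blinfun_apply T v) \<le> B * norm v" for v
    proof (cases "v = 0")
      case False
      have "norm (blinfun_apply T ((1 / norm v) *\<^sub>R v)) \<le> B" using False by (intro unit) simp
      then show ?thesis using False by (simp add: blinfun.scaleR_right field_simps)
    qed simp
  qed
qed

text \<open>Under every functional the n-th difference quotient is within K/n of the directional
  derivative, with the same K for all of them. As the set is norming, the quotients are Cauchy in
  norm, and completeness supplies the vector.\<close>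

lemma weak_derivative_exists:
  fixes G :: "'a::complex_normed_vector \<Rightarrow> 'b::banach"
  assumes \<Phi>: "norming_set \<Phi>" and G: "weakly_holomorphic \<Phi> r G" and r: "r > 0"
    and x: "norm x < r / 2"
  shows "\<exists>y. \<forall>\<phi>\<in>\<Phi>. \<phi> y = dir_deriv (\<lambda>x. \<phi> (G x)) x v"
proof -
  obtain M where M: "\<And>x. norm x < r \<Longrightarrow> norm (G x) \<le> M"
    and hol: "\<And>\<phi>. \<phi> \<in> \<Phi> \<Longrightarrow> gateaux_holomorphic_on (\<lambda>x. \<phi> (G x)) (ball 0 r)"
    using G unfolding weakly_holomorphic_def by blast
  have bd: "cmod (\<phi> (G x)) \<le> M" if "\<phi> \<in> \<Phi>" "norm x < r" for \<phi> x
    using norming_set_le[OF \<Phi> that(1)] M[OF that(2)] order_trans by blast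
  obtain n0 :: nat where "norm v / (r / 4) < real n0" using reals_Archimedean2 by blast
  then have n0: "norm v \<le> r / 4 * real n0" using r by (simp add: field_simps)
  define K where "K = 128 * M / r\<^sup>2 * (norm v)\<^sup>2"
  define Q where "Q n = real n *\<^sub>R (G (x + (1 / real n) *\<^sub>R v) - G x)" for n
  have Q: "cmod (\<phi> (Q n) - dir_deriv (\<lambda>x. \<phi> (G x)) x v) \<le> K / real n"
    if "\<phi> \<in> \<Phi>" "n \<ge> Suc n0" for \<phi> n
  proof -
    interpret bounded_linear \<phi> by (rule norming_set_linear[OF \<Phi> that(1)])
    have "norm v \<le> r / 4 * real n"
      using n0 r that(2) by (rule_tac order_trans[OF n0]) (intro mult_left_mono, auto)
    from dir_deriv_quotient[OF hol[OF that(1)] bd[OF that(1)] r x _ this]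
    show ?thesis using that(2) by (simp add: Q_def K_def scaleR diff scaleR_conv_of_real)
  qed
  have lim: "(\<lambda>n. K / real n) \<longlonglongrightarrow> 0" by (rule lim_const_over_n)
  have "Cauchy Q"
  proof (rule CauchyI)
    fix e :: real assume "e > 0"
    then have "\<forall>\<^sub>F n in sequentially. K / real n < e / 2" by (intro order_tendstoD[OF lim]) simp
    then obtain N where N: "\<And>n. n \<ge> N \<Longrightarrow> K / real n < e / 2" by (auto simp: eventually_sequentially)
    have "norm (Q m - Q n) < e" if "m \<ge> max N (Suc n0)" "n \<ge> max N (Suc n0)" for m n
    proof -
      have "norm (Q m - Q n) \<le> K / real m + K / real n"
      proof (rule norming_set_bound[OF \<Phi>])
        fix \<phi> assume \<phi>: "\<phi> \<in> \<Phi>"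
        interpret bounded_linear \<phi> by (rule norming_set_linear[OF \<Phi> \<phi>])
        show "cmod (\<phi> (Q m - Q n)) \<le> K / real m + K / real n"
          using Q[OF \<phi>, of m] Q[OF \<phi>, of n] that
            norm_triangle_ineq4[of "\<phi> (Q m) - dir_deriv (\<lambda>x. \<phi> (G x)) x v" "\<phi> (Q n) - dir_deriv (\<lambda>x. \<phi> (G x)) x v"]
          by (simp add: diff)
      qed
      moreover have "K / real m < e / 2" by (rule N) (use that in simp)
      moreover have "K / real n < e / 2" by (rule N) (use that in simp)
      ultimately show ?thesis by linarith
    qed
    then show "\<exists>M. \<forall>m\<ge>M. \<forall>n\<ge>M. norm (Q m - Q n) < e" by blast
  qed
  then obtain y where y: "Q \<longlonglongrightarrow> y" using Cauchy_convergent_iff convergent_def by blast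
  have "\<phi> y = dir_deriv (\<lambda>x. \<phi> (G x)) x v" if \<phi>: "\<phi> \<in> \<Phi>" for \<phi>
  proof (rule LIMSEQ_unique)
    show "(\<lambda>n. \<phi> (Q n)) \<longlonglongrightarrow> \<phi> y"
      by (rule bounded_linear.tendsto[OF norming_set_linear[OF \<Phi> \<phi>] y])
    have "\<forall>\<^sub>F n in sequentially. norm (\<phi> (Q n) - dir_deriv (\<lambda>x. \<phi> (G x)) x v) \<le> K / real n"
      using eventually_ge_at_top[of "Suc n0"] by eventually_elim (rule Q[OF \<phi>])
    then have "(\<lambda>n. \<phi> (Q n) - dir_deriv (\<lambda>x. \<phi> (G x)) x v) \<longlonglongrightarrow> 0"
      by (rule Lim_null_comparison[OF _ lim])
    then show "(\<lambda>n. \<phi> (Q n)) \<longlonglongrightarrow> dir_deriv (\<lambda>x. \<phi> (G x)) x v"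
      using Lim_null by blast
  qed
  then show ?thesis by blast
qed

text \<open>A second-order remainder bound that is uniform over a norming set of functionals is a bound
  in norm, so it upgrades weak differentiability to Frechet differentiability.\<close>

lemma weakly_holomorphic_derivative:
  fixes G :: "'a::complex_normed_vector \<Rightarrow> 'b::banach"
  assumes \<Phi>: "norming_set \<Phi>" and G: "weakly_holomorphic \<Phi> r G" and r: "r > 0"
  shows "norm x < r / 2 \<Longrightarrow> (G has_derivative fderiv G x) (at x)"
    and "weakly_holomorphic (lift_functionals \<Phi>) (r / 2) (fderiv G)"
proof -
  obtain M where M: "\<And>x. norm x < r \<Longrightarrow> norm (G x) \<le> M"
    and hol: "\<And>\<phi>. \<phi> \<in> \<Phi> \<Longrightarrow> gateaux_holomorphic_on (\<lambda>x. \<phi> (G x)) (ball 0 r)"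
    using G unfolding weakly_holomorphic_def by blast
  have bd: "cmod (\<phi> (G x)) \<le> M" if "\<phi> \<in> \<Phi>" "norm x < r" for \<phi> x
    using norming_set_le[OF \<Phi> that(1)] M[OF that(2)] order_trans by blast
  have "\<exists>L. norm L \<le> 4 * M / r \<and> (\<forall>\<phi>\<in>\<Phi>. \<forall>v. \<phi> (blinfun_apply L v) = dir_deriv (\<lambda>x. \<phi> (G x)) x v) \<and>
      (G has_derivative L) (at x)" if x: "norm x < r / 2" for x
  proof -
    have "\<forall>v. \<exists>y. \<forall>\<phi>\<in>\<Phi>. \<phi> y = dir_deriv (\<lambda>x. \<phi> (G x)) x v"
      using weak_derivative_exists[OF \<Phi> G r x] by blast
    then obtain L where L: "\<And>v \<phi>. \<phi> \<in> \<Phi> \<Longrightarrow> \<phi> (L v) = dir_deriv (\<lambda>x. \<phi> (G x)) x v"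
      by metis
    have lin: "L (u + v) = L u + L v" for u v
    proof (rule norming_set_eqI[OF \<Phi>])
      fix \<phi> assume \<phi>: "\<phi> \<in> \<Phi>"
      show "\<phi> (L (u + v)) = \<phi> (L u + L v)"
        using dir_deriv_add[OF hol[OF \<phi>] bd[OF \<phi>] r x]
        by (simp add: L[OF \<phi>] linear_add[OF bounded_linear.linear[OF norming_set_linear[OF \<Phi> \<phi>]]])
    qed
    have sc: "L (c *\<^sub>R v) = c *\<^sub>R L v" for c v
    proof (rule norming_set_eqI[OF \<Phi>])
      fix \<phi> assume \<phi>: "\<phi> \<in> \<Phi>"
      have "dir_deriv (\<lambda>x. \<phi> (G x)) x (of_real c *\<^sub>C v) = of_real c * dir_deriv (\<lambda>x. \<phi> (G x)) x v"
        using x r by (intro dir_deriv_scaleC[OF hol[OF \<phi>] bd[OF \<phi>] r]) auto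
      then show "\<phi> (L (c *\<^sub>R v)) = \<phi> (c *\<^sub>R L v)"
        using \<phi> by (simp add: L linear_cmul[OF bounded_linear.linear[OF norming_set_linear[OF \<Phi>]]]
            scaleR_conv_of_real flip: scaleR_scaleC)
    qed
    have bnd: "norm (L v) \<le> norm v * (4 * M / r)" for v
    proof (rule norming_set_bound[OF \<Phi>])
      fix \<phi> assume \<phi>: "\<phi> \<in> \<Phi>"
      show "cmod (\<phi> (L v)) \<le> norm v * (4 * M / r)"
        using dir_deriv_bound[OF hol[OF \<phi>] bd[OF \<phi>] r x, of v] by (simp add: L[OF \<phi>] mult.commute)
    qed
    have bl: "bounded_linear L" by (rule bounded_linear_intro[OF lin sc bnd])
    have "M \<ge> 0" using order_trans[OF norm_ge_zero M[of 0]] r by simp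
    have "(G has_derivative L) (at x)"
      unfolding has_derivative_at
    proof (intro conjI bl)
      let ?K = "128 * M / r\<^sup>2"
      have rem: "norm (G (x + h) - G x - L h) \<le> ?K * (norm h)\<^sup>2" if "norm h \<le> r / 4" for h
      proof (rule norming_set_bound[OF \<Phi>])
        fix \<phi> assume \<phi>: "\<phi> \<in> \<Phi>"
        interpret bounded_linear \<phi> by (rule norming_set_linear[OF \<Phi> \<phi>])
        show "cmod (\<phi> (G (x + h) - G x - L h)) \<le> ?K * (norm h)\<^sup>2"
          using dir_deriv_remainder[OF hol[OF \<phi>] bd[OF \<phi>] r x that] \<phi> by (simp add: diff L)
      qed
      have lim: "\<forall>\<^sub>F h in at 0. norm (norm (G (x + h) - G x - L h) / norm h) \<le> ?K * norm h"
      proof -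
        have "\<forall>\<^sub>F h in at (0::'a). norm h < r / 4"
          using r by (auto simp: eventually_at dist_norm intro!: exI[of _ "r / 4"])
        then show ?thesis
        proof eventually_elim
          case (elim h)
          then show ?case using rem[of h] by (cases "h = 0") (simp_all add: field_simps power2_eq_square)
        qed
      qed
      have "((\<lambda>h::'a. ?K * norm h) \<longlongrightarrow> 0) (at 0)"
        by (intro tendsto_mult_right_zero tendsto_norm_zero tendsto_ident_at)
      with lim show "((\<lambda>h. norm (G (x + h) - G x - L h) / norm h) \<longlongrightarrow> 0) (at 0)"
        by (rule Lim_null_comparison)
    qed
    moreover have "norm (Blinfun L) \<le> 4 * M / r"
      using bnd \<open>M \<ge> 0\<close> r by (intro norm_blinfun_bound) (auto simp: bounded_linear_Blinfun_apply[OF bl] mult.commute)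
    ultimately show ?thesis
      using L by (intro exI[of _ "Blinfun L"]) (simp add: bounded_linear_Blinfun_apply[OF bl])
  qed
  \<comment> \<open>By uniqueness of derivatives the operator found above is
    \<open>fderiv G x\<close>, which inherits its bound and its values under the
    functionals.\<close>
  then have fd: "norm (fderiv G x) \<le> 4 * M / r \<and>
      (\<forall>\<phi>\<in>\<Phi>. \<forall>v. \<phi> (fderiv G x v) = dir_deriv (\<lambda>x. \<phi> (G x)) x v) \<and>
      (G has_derivative fderiv G x) (at x)" if "norm x < r / 2" for x
    using that fderiv_eqI by metis
  then show "norm x < r / 2 \<Longrightarrow> (G has_derivative fderiv G x) (at x)" by blast
  show "weakly_holomorphic (lift_functionals \<Phi>) (r / 2) (fderiv G)"
    unfolding weakly_holomorphic_def
  proof (intro conjI ballI)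
    show "\<exists>M. \<forall>x. norm x < r / 2 \<longrightarrow> norm (fderiv G x) \<le> M" using fd by blast
    fix \<psi> :: "('a \<Rightarrow>\<^sub>L 'b) \<Rightarrow> complex" assume "\<psi> \<in> lift_functionals \<Phi>"
    then obtain \<phi> v where \<psi>: "\<psi> = (\<lambda>T. \<phi> (blinfun_apply T v))" and \<phi>: "\<phi> \<in> \<Phi>"
      by (auto simp: lift_functionals_def)
    show "gateaux_holomorphic_on (\<lambda>x. \<psi> (fderiv G x)) (ball 0 (r / 2))"
      unfolding gateaux_holomorphic_on_def
    proof (intro allI)
      fix x u
      show "(\<lambda>\<zeta>. \<psi> (fderiv G (x + \<zeta> *\<^sub>C u))) holomorphic_on {\<zeta>. x + \<zeta> *\<^sub>C u \<in> ball 0 (r / 2)}"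
        by (rule holomorphic_transform[OF dir_deriv_holomorphic[OF hol[OF \<phi>] bd[OF \<phi>] r, of x u v]])
           (use \<phi> fd in \<open>auto simp: \<psi>\<close>)
    qed
  qed
qed

section \<open>Starlike functions of the unit disc\<close>

lemma taylor_coeff_has_integral:
  assumes hol: "q holomorphic_on ball 0 1" and r: "0 < r" "r < 1"
  shows "((\<lambda>t. q (of_real r * exp (2 * of_real pi * \<i> * of_real t)) / exp (2 * of_real pi * \<i> * of_real t) ^ k)
           has_integral (fps_nth (fps_expansion q 0) k * of_real r ^ k)) {0..1}"
proof -
  have sub: "cball 0 r \<subseteq> ball (0::complex) 1" using r by auto
  have "((\<lambda>u. q u / (u - 0) ^ Suc k) has_contour_integral
      ((2 * pi * \<i>) / fact k * (deriv ^^ k) q 0)) (circlepath 0 r)"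
  proof (rule Cauchy_has_contour_integral_higher_derivative_circlepath)
    show "continuous_on (cball 0 r) q"
      by (rule holomorphic_on_imp_continuous_on[OF holomorphic_on_subset[OF hol sub]])
    show "q holomorphic_on ball 0 r"
      using r by (intro holomorphic_on_subset[OF hol]) auto
  qed (use r in auto)
  then have "((\<lambda>t. q (circlepath 0 r t) / circlepath 0 r t ^ Suc k * vector_derivative (circlepath 0 r) (at t))
      has_integral ((2 * pi * \<i>) / fact k * (deriv ^^ k) q 0)) {0..1}"
    by (simp add: has_contour_integral)
  from has_integral_mult_right[OF this[unfolded vector_derivative_circlepath], of "of_real r ^ k / (2 * pi * \<i>)"]
  show ?thesis
    using r by (simp add: fps_expansion_def circlepath field_simps power_mult_distrib)
qed

text \<open>Estimates made on circles of radius r < 1 carry over to the coefficients as r tends to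
  1, so boundary values never occur.\<close>

lemma le_of_le_mult_power:
  fixes c C :: real
  assumes "\<And>r. 0 < r \<Longrightarrow> r < 1 \<Longrightarrow> c * r ^ n \<le> C"
  shows "c \<le> C"
proof (rule tendsto_upperbound)
  have "((\<lambda>r. c * r ^ n) \<longlongrightarrow> c * 1 ^ n) (at_left 1)" by (intro tendsto_intros)
  then show "((\<lambda>r. c * r ^ n) \<longlongrightarrow> c) (at_left (1::real))" by simp
  have "\<forall>\<^sub>F r in at_left (1::real). r \<in> {0<..<1}" by (rule eventually_at_leftI[of 0]) auto
  then show "\<forall>\<^sub>F r in at_left 1. c * r ^ n \<le> C" by eventually_elim (use assms in auto)
qed simp

text \<open>The coefficients of \<open>p\<close> are, up to a factor, the moments of the positive measure
  \<open>Re p\<close> on a circle. For the last bound, put \<open>a = P\<^sub>1 r\<close>: then \<open>(P\<^sub>3 - P\<^sub>1 P\<^sub>2) r\<^sup>3\<close> is twice the integral of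
  \<open>e\<^sup>-\<^sup>2\<^sup>i\<^sup>t (e\<^sup>-\<^sup>i\<^sup>t - a)\<close>, and the mean square of \<open>e\<^sup>-\<^sup>i\<^sup>t - a\<close> is exactly 1.\<close>

lemma caratheodory_coeff_bounds:
  assumes hol: "p holomorphic_on ball 0 1" and p0: "p 0 = 1"
    and pos: "\<And>z. z \<in> ball 0 1 \<Longrightarrow> Re (p z) \<ge> 0"
  defines "P \<equiv> fps_nth (fps_expansion p 0)"
  shows "k > 0 \<Longrightarrow> cmod (P k) \<le> 2" and "cmod (P 3 - P 1 * P 2) \<le> 2"
proof -
  define e where "e t = exp (2 * of_real pi * \<i> * of_real t)" for t :: real
  have e_norm [simp]: "cmod (e t) = 1" for t by (simp add: e_def)
  have e_nz [simp]: "e t \<noteq> 0" for t by (simp add: e_def)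
  have e_cnj: "cnj (e t) = 1 / e t" for t
    using complex_norm_square[of "e t"] by (simp add: field_simps)
  define u where "u r t = Re (p (of_real r * e t))" for r t :: real
  have u_nonneg: "u r t \<ge> 0" if "0 < r" "r < 1" for r t
    unfolding u_def using that by (intro pos) (auto simp: norm_mult)
  have pos_coeff: "((\<lambda>t. p (of_real r * e t) / e t ^ k) has_integral (P k * of_real r ^ k)) {0..1}"
    if "0 < r" "r < 1" for r k
    using taylor_coeff_has_integral[OF hol that, of k] by (simp add: P_def e_def)
  have P0: "P 0 = 1" by (simp add: P_def fps_expansion_def p0)
  \<comment> \<open>The Fourier coefficients of negative order vanish: up to a power of r they are
    the constant coefficients of p(z) z^k.\<close>
  have neg_coeff: "((\<lambda>t. p (of_real r * e t) * e t ^ k) has_integral 0) {0..1}"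
    if "0 < r" "r < 1" "k > 0" for r k
  proof -
    have "(\<lambda>z. p z * z ^ k) holomorphic_on ball 0 1" by (intro holomorphic_intros hol)
    from has_integral_mult_right[OF taylor_coeff_has_integral[OF this that(1,2), of 0], of "1 / of_real r ^ k"]
    show ?thesis using that by (simp add: e_def zero_power fps_expansion_def power_mult_distrib)
  qed
  \<comment> \<open>Adding the conjugate of a vanishing coefficient replaces p by its real part at
    the cost of a factor 1/2.\<close>
  have moment: "((\<lambda>t. of_real (u r t) / e t ^ k) has_integral (P k * of_real r ^ k / 2)) {0..1}"
    if r: "0 < r" "r < 1" and k: "k > 0" for r k
  proof -
    have "((cnj \<circ> (\<lambda>t. p (of_real r * e t) * e t ^ k)) has_integral cnj 0) {0..1}"
      using neg_coeff[OF r k] by (simp only: has_integral_cnj)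
    from has_integral_mult_right[OF has_integral_add[OF pos_coeff[OF r, of k] this], of "1 / 2"]
    have "((\<lambda>t. (p (of_real r * e t) / e t ^ k + cnj (p (of_real r * e t) * e t ^ k)) / 2)
        has_integral (P k * of_real r ^ k / 2)) {0..1}"
      by simp
    moreover have "(p (of_real r * e t) / e t ^ k + cnj (p (of_real r * e t) * e t ^ k)) / 2
        = of_real (u r t) / e t ^ k" for t
    proof -
      have "(c / E + cnj c / E) / 2 = of_real (Re c) / E" for c E
        by (simp add: complex_add_cnj flip: add_divide_distrib)
      then show ?thesis by (simp add: u_def e_cnj power_one_over)
    qed
    ultimately show ?thesis by simp
  qed
  have mass: "((\<lambda>t. u r t) has_integral 1) {0..1}" if r: "0 < r" "r < 1" for r
    using has_integral_linear[OF pos_coeff[OF r, of 0] bounded_linear_Re] by (simp add: u_def o_def P0)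
  show "cmod (P k) \<le> 2" if k: "k > 0" for k
  proof (rule le_of_le_mult_power[of _ k])
    fix r :: real assume r: "0 < r" "r < 1"
    have "norm (integral {0..1} (\<lambda>t. of_real (u r t) / e t ^ k)) \<le> integral {0..1} (u r)"
      using moment[OF r k] mass[OF r] u_nonneg[OF r]
      by (intro integral_norm_bound_integral) (auto simp: norm_divide norm_power has_integral_integrable)
    then show "cmod (P k) * r ^ k \<le> 2"
      using moment[OF r k] mass[OF r] r
      by (simp add: integral_unique norm_mult norm_divide norm_power)
  qed
  show "cmod (P 3 - P 1 * P 2) \<le> 2"
  proof (rule le_of_le_mult_power[of _ 3])
    fix r :: real assume r: "0 < r" "r < 1"
    define a where "a = P 1 * of_real r"
    define f where "f t = of_real (u r t) / e t ^ 3 - a * (of_real (u r t) / e t ^ 2)" for t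
    \<comment> \<open>This is \<open>u r t\<close> times (1 + w^2) / 2, where w is the modulus of 1
      / \<open>e t\<close> - a, and it dominates f by 2 w <= 1 + w^2. The first moment is a/2, so
      the cross term cancels the square of a; both 1 and w^2 have mean 1 and g integrates to
      1.\<close>
    define g where "g t = u r t * (1 + (cmod a)\<^sup>2 / 2) - Re (cnj a * (of_real (u r t) / e t ^ 1))" for t
    have "(f has_integral (P 3 * of_real r ^ 3 / 2 - a * (P 2 * of_real r ^ 2 / 2))) {0..1}"
      unfolding f_def by (intro has_integral_diff has_integral_mult_right moment r) auto
    moreover have "P 3 * of_real r ^ 3 / 2 - a * (P 2 * of_real r ^ 2 / 2)
        = (P 3 - P 1 * P 2) * of_real r ^ 3 / 2"
      by (simp add: a_def power2_eq_square power3_eq_cube algebra_simps)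
    ultimately have f: "(f has_integral ((P 3 - P 1 * P 2) * of_real r ^ 3 / 2)) {0..1}" by (simp only:)
    have "((Re \<circ> (\<lambda>t. cnj a * (of_real (u r t) / e t ^ 1))) has_integral Re (cnj a * (P 1 * of_real r ^ 1 / 2))) {0..1}"
      by (intro has_integral_linear[OF _ bounded_linear_Re] has_integral_mult_right moment r) auto
    moreover have "Re (cnj a * (P 1 * of_real r ^ 1 / 2)) = (cmod a)\<^sup>2 / 2"
      unfolding a_def[symmetric] power_one_right using complex_norm_square[of a]
      by (simp add: mult.commute[of "cnj a"] flip: complex_norm_square)
    ultimately have "((\<lambda>t. Re (cnj a * (of_real (u r t) / e t ^ 1))) has_integral (cmod a)\<^sup>2 / 2) {0..1}"
      unfolding o_def by (simp only:)
    from has_integral_diff[OF has_integral_mult_left[OF mass[OF r]] this]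
    have "(g has_integral 1 * (1 + (cmod a)\<^sup>2 / 2) - (cmod a)\<^sup>2 / 2) {0..1}"
      unfolding g_def .
    then have g: "(g has_integral 1) {0..1}" by simp
    have fg: "norm (f t) \<le> g t" for t
    proof -
      let ?w = "1 / e t - a"
      have sq: "(cmod ?w)\<^sup>2 = 1 + (cmod a)\<^sup>2 - 2 * Re (cnj a / e t)"
      proof -
        define v where "v = 1 / e t"
        have "(cmod (v - a))\<^sup>2 = (cmod v)\<^sup>2 + (cmod a)\<^sup>2 - 2 * (v \<bullet> a)"
          by (simp add: power2_norm_eq_inner inner_diff_left inner_diff_right inner_commute)
        moreover have "v \<bullet> a = Re (cnj a * v)" by (simp add: inner_complex_def)
        ultimately show ?thesis by (simp add: v_def norm_divide)
      qed
      have "f t = of_real (u r t) * ?w / e t ^ 2"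
        by (simp add: f_def field_simps power2_eq_square power3_eq_cube)
      then have "norm (f t) = u r t * cmod ?w"
        using u_nonneg[OF r, of t] by (simp add: norm_mult norm_divide norm_power)
      also have "\<dots> \<le> u r t * ((1 + (cmod ?w)\<^sup>2) / 2)"
        using sum_squares_bound[of 1 "cmod ?w"] by (intro mult_left_mono u_nonneg r) auto
      also have "\<dots> = g t"
      proof -
        have "cnj a * (of_real (u r t) / e t ^ 1) = of_real (u r t) * (cnj a / e t)" by simp
        then have "g t = u r t * (1 + (cmod a)\<^sup>2 / 2) - u r t * Re (cnj a / e t)"
          by (simp only: g_def times_complex.sel Re_complex_of_real Im_complex_of_real)
        then show ?thesis unfolding sq by (simp add: algebra_simps add_divide_distrib diff_divide_distrib)
      qed
      finally show ?thesis .
    qed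
    have "norm (integral {0..1} f) \<le> integral {0..1} g"
      using f g fg by (intro integral_norm_bound_integral) (auto simp: has_integral_integrable)
    then show "cmod (P 3 - P 1 * P 2) * r ^ 3 \<le> 2"
      using f g r by (simp add: integral_unique norm_mult norm_divide norm_power)
  qed
qed

section \<open>Starlikeness and the real part of z h'(z) / h(z)\<close>

text \<open>By starlikeness the map sending z to the preimage of t h(z) is a holomorphic self-map of
  the disc fixing 0, so the Schwarz lemma applies.\<close>

lemma starlike_preimage_norm_le:
  assumes hol: "h holomorphic_on ball 0 1" and inj: "inj_on h (ball 0 1)" and h0: "h 0 = 0"
    and star: "\<And>z s. z \<in> ball 0 1 \<Longrightarrow> s \<in> {0..1} \<Longrightarrow> of_real s * h z \<in> h ` ball 0 1"
    and w: "w \<in> ball 0 1" and z: "z \<in> ball 0 1" and t: "t \<in> {0..1}" and eq: "h w = of_real t * h z"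
  shows "cmod w \<le> cmod z"
proof -
  obtain k where k: "k holomorphic_on h ` ball 0 1" "\<And>z. z \<in> ball 0 1 \<Longrightarrow> k (h z) = z"
    by (rule holomorphic_has_inverse[OF hol open_ball inj]) (rule that)
  have "cmod (k (of_real t * h z)) \<le> cmod z"
  proof (rule Schwarz_Lemma)
    show "(\<lambda>z. k (of_real t * h z)) holomorphic_on ball 0 1"
      using star t by (intro holomorphic_on_compose_gen[OF _ k(1), unfolded o_def] holomorphic_intros hol) auto
    show "k (of_real t * h 0) = 0" using k(2)[of 0] by (simp add: h0)
    show "cmod (k (of_real t * h z)) < 1" if "cmod z < 1" for z
      using star[of z t] that t k(2) by auto
  qed (use z in auto)
  then show ?thesis using k(2)[OF w] by (simp flip: eq)
qed

text \<open>Differentiate the norm of \<open>h\<^sup>-\<^sup>1 (t h z)\<close>, which the Schwarz lemma bounds by the norm of \<open>z\<close>, at \<open>t = 1\<close>.\<close>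

lemma starlike_Re_nonneg:
  assumes hol: "h holomorphic_on ball 0 1" and inj: "inj_on h (ball 0 1)" and h0: "h 0 = 0"
    and star: "\<And>z s. z \<in> ball 0 1 \<Longrightarrow> s \<in> {0..1} \<Longrightarrow> of_real s * h z \<in> h ` ball 0 1"
    and z: "z \<in> ball 0 1"
  shows "Re (z * deriv h z / h z) \<ge> 0"
proof -
  obtain k where k: "k holomorphic_on h ` ball 0 1"
    "\<And>z. z \<in> ball 0 1 \<Longrightarrow> deriv h z * deriv k (h z) = 1" "\<And>z. z \<in> ball 0 1 \<Longrightarrow> k (h z) = z"
    by (rule holomorphic_has_inverse[OF hol open_ball inj]) (rule that)
  have opn: "open (h ` ball 0 1)" by (rule open_mapping_thm3[OF hol open_ball inj])
  have "(k has_field_derivative deriv k (h z)) (at (of_real 1 * h z))"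
    using holomorphic_derivI[OF k(1) opn, of "h z"] z by auto
  moreover have "((\<lambda>t. of_real t * h z) has_vector_derivative h z) (at 1)"
    by (auto intro!: derivative_eq_intros)
  ultimately have "((k \<circ> (\<lambda>t. of_real t * h z)) has_vector_derivative (h z * deriv k (h z))) (at 1)"
    by (intro field_vector_diff_chain_at) auto
  then have d: "((\<lambda>t. k (of_real t * h z)) has_vector_derivative (h z * deriv k (h z))) (at (1::real))"
    by (simp add: o_def)
  define D where "D = h z * deriv k (h z)"
  define m where "m t = k (of_real t * h z) \<bullet> k (of_real t * h z)" for t :: real
  have kz: "k (h z) = z" using k(3) z by blast
  have "(m has_real_derivative (z \<bullet> D + D \<bullet> z)) (at 1)"
    unfolding m_def has_field_derivative_def
    by (rule has_derivative_eq_rhs[OF has_derivative_inner[OF d[unfolded has_vector_derivative_def]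
            d[unfolded has_vector_derivative_def]]])
       (simp add: kz D_def fun_eq_iff algebra_simps)
  then have m': "(m has_real_derivative (2 * (z \<bullet> D))) (at 1)" by (simp add: inner_commute)
  have "z \<bullet> D \<ge> 0"
  proof (rule ccontr)
    assume "\<not> z \<bullet> D \<ge> 0"
    then obtain d where d: "d > 0" "\<And>s. s > 0 \<Longrightarrow> s < d \<Longrightarrow> m 1 < m (1 - s)"
      using DERIV_neg_dec_left[OF m'] by auto
    define s where "s = min (d / 2) 1"
    have s: "s > 0" "s < d" "1 - s \<in> {0..1}" using d(1) by (auto simp: s_def)
    obtain w where w: "w \<in> ball 0 1" "h w = of_real (1 - s) * h z" using star[OF z s(3)] by auto
    have "m (1 - s) = (cmod w)\<^sup>2" using k(3)[OF w(1)] by (simp add: m_def w(2) flip: power2_norm_eq_inner)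
    also have "\<dots> \<le> (cmod z)\<^sup>2"
      by (intro power_mono starlike_preimage_norm_le[OF hol inj h0 star w(1) z s(3) w(2)]) auto
    also have "\<dots> = m 1" by (simp add: m_def kz power2_norm_eq_inner)
    finally show False using d(2)[OF s(1,2)] by simp
  qed
  have nz: "deriv h z \<noteq> 0" using k(2)[OF z] by auto
  have D: "D = h z / deriv h z" using k(2)[OF z] nz by (simp add: D_def field_simps)
  show ?thesis
  \<comment> \<open>The quotient is z / D, whose real part has the sign of that of z times the
    conjugate of D. Where h z = 0 it is 0 by the convention for division.\<close>
  proof (cases "h z = 0")
    case False
    have "z * cnj D / of_real ((cmod D)\<^sup>2) = z * cnj D / (D * cnj D)"
      by (simp only: complex_norm_square)
    also have "\<dots> = z * deriv h z / h z"
      using False nz by (simp add: D)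
    finally have "z * deriv h z / h z = z * cnj D / of_real ((cmod D)\<^sup>2)" by simp
    then have "Re (z * deriv h z / h z) = Re (z * cnj D) / (cmod D)\<^sup>2"
      by (simp only: Re_divide_of_real)
    also have "Re (z * cnj D) = z \<bullet> D" by (simp add: inner_complex_def)
    finally show ?thesis using \<open>z \<bullet> D \<ge> 0\<close> by simp
  qed simp
qed

lemma starlike_coeff_bound:
  assumes hol: "h holomorphic_on ball 0 1" and inj: "inj_on h (ball 0 1)" and h0: "h 0 = 0"
    and h1: "deriv h 0 = 1"
    and star: "\<And>z s. z \<in> ball 0 1 \<Longrightarrow> s \<in> {0..1} \<Longrightarrow> of_real s * h z \<in> h ` ball 0 1"
  defines "a \<equiv> fps_nth (fps_expansion h 0)"
  shows "cmod ((a 2 - a 4) * ((a 2)\<^sup>2 - 2 * (a 3)\<^sup>2 + a 2 * a 4)) \<le> 84"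
proof -
  \<comment> \<open>h(z) / z with its singularity removed. It has no zeros, so h' / g defines p at
    the origin as well.\<close>
  define g where "g z = (if z = 0 then deriv h 0 else (h z - h 0) / (z - 0))" for z
  have g_hol: "g holomorphic_on ball 0 1"
    unfolding g_def by (rule pole_lemma_open[OF hol open_ball])
  have hg: "h z = z * g z" for z by (simp add: g_def h0)
  have g_nz: "g z \<noteq> 0" if "z \<in> ball 0 1" for z
  proof
    assume "g z = 0"
    then have "h z = h 0" "z \<noteq> 0" using h1 h0 hg[of z] by (auto simp: g_def)
    then show False using inj that by (auto simp: inj_on_def)
  qed
  define p where "p z = deriv h z / g z" for z
  have p_hol: "p holomorphic_on ball 0 1"
    unfolding p_def by (intro holomorphic_intros holomorphic_deriv hol g_hol g_nz) auto
  have p0: "p 0 = 1" by (simp add: p_def g_def h1)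
  have "Re (p z) \<ge> 0" if "z \<in> ball 0 1" for z
  proof (cases "z = 0")
    case False
    then have "p z = z * deriv h z / h z" by (simp add: p_def hg)
    then show ?thesis using starlike_Re_nonneg[OF hol inj h0 star that] by simp
  qed (simp add: p0)
  note P_bounds = caratheodory_coeff_bounds[OF p_hol p0 this]
  define P where "P = fps_nth (fps_expansion p 0)"
  have P: "cmod (P 1) \<le> 2" "cmod (P 2) \<le> 2" "cmod (P 3) \<le> 2" "cmod (P 3 - P 1 * P 2) \<le> 2"
    unfolding P_def by (intro P_bounds; simp)+
  have H: "h has_fps_expansion fps_expansion h 0" and Pe: "p has_fps_expansion fps_expansion p 0"
    using hol p_hol by (auto intro!: has_fps_expansion_fps_expansion[of "ball 0 1"])
  have e1: "(\<lambda>z. p z * h z) has_fps_expansion fps_expansion p 0 * fps_expansion h 0"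
    by (intro has_fps_expansion_mult Pe H)
  have e2: "(\<lambda>z. z * deriv h z) has_fps_expansion fps_X * fps_deriv (fps_expansion h 0)"
    by (intro has_fps_expansion_mult has_fps_expansion_fps_X has_fps_expansion_deriv H)
  have e3: "\<forall>\<^sub>F z in nhds 0. p z * h z = z * deriv h z"
  proof (rule eventually_nhds_in_open[THEN eventually_mono])
    show "p z * h z = z * deriv h z" if "z \<in> ball 0 1" for z
      using g_nz[OF that] by (simp add: p_def hg)
  qed auto
  have eq: "fps_expansion p 0 * fps_expansion h 0 = fps_X * fps_deriv (fps_expansion h 0)"
    by (rule fps_expansion_unique_complex[OF e1 iffD2[OF has_fps_expansion_cong[OF e3 refl] e2]])
  have P0: "P 0 = 1" by (simp add: P_def fps_expansion_def p0)
  have a01: "a 0 = 0" "a 1 = 1" by (simp_all add: a_def fps_expansion_def h0 h1)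
  have rec: "(\<Sum>i=0..n. P i * a (n - i)) = of_nat n * a n" if "n > 0" for n
  proof -
    have "fps_nth (fps_expansion p 0 * fps_expansion h 0) n = (\<Sum>i=0..n. P i * a (n - i))"
      by (simp add: fps_mult_nth P_def a_def)
    then show ?thesis using that unfolding eq by (simp add: a_def)
  qed
  have r2: "a 2 = P 1"
    using rec[of 2] a01 P0 by (simp add: numeral_2_eq_2)
  have r3: "a 3 = (P 2 + P 1 * P 1) / 2"
    using rec[of 3] a01 P0 r2 by (simp add: numeral_3_eq_3 numeral_2_eq_2 field_simps)
  have r4: "a 4 = P 3 / 3 + P 1 * P 2 / 2 + P 1 ^ 3 / 6"
  proof -
    have "{0..4::nat} = {0,1,2,3,4}" by auto
    then have "a 4 + P 1 * a 3 + P 2 * a 2 + P 3 * a 1 = 4 * a 4"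
      using rec[of 4] a01 P0 by simp
    then have "3 * a 4 = P 3 + P 2 * P 1 + P 1 * ((P 2 + P 1 * P 1) / 2)"
      by (simp add: a01(2)[unfolded One_nat_def] r2 r3 algebra_simps)
    then show ?thesis by (simp add: field_simps power3_eq_cube)
  qed
  note norms = norm_mult norm_power norm_divide
  have b12: "cmod (P 1 * P 2) \<le> 4" 
    unfolding norm_mult using mult_mono[OF P(1,2)] by simp
  have b1n: "cmod (P 1) ^ n \<le> 2 ^ n" for n using P(1) by (intro power_mono) auto
  have "cmod (a 2 - a 4) \<le> cmod (a 2) + cmod (a 4)" by (rule norm_triangle_ineq4)
  also have "cmod (a 4) \<le> cmod (P 3 / 3) + cmod (P 1 * P 2 / 2) + cmod (P 1 ^ 3 / 6)"
    unfolding r4 by (intro norm_triangle_mono order_refl)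
  also have "\<dots> \<le> 2 / 3 + 2 + 8 / 6"
    using P(3) b12 b1n[of 3] by (simp add: norms)
  finally have A: "cmod (a 2 - a 4) \<le> 6" using P(1) r2 by simp
  \<comment> \<open>The term in P1 P3 enters with a minus sign, and part of the term in P1^2 P2 is
    absorbed into it. Bounding the two separately would give 38/3 for the bracket instead of
    10.\<close>
  have B_eq: "(a 2)\<^sup>2 - 2 * (a 3)\<^sup>2 + a 2 * a 4
      = (P 1)\<^sup>2 - ((P 2)\<^sup>2 / 2 + (P 1)\<^sup>2 * P 2 / 6 + P 1 ^ 4 / 3 + - (P 1 * (P 3 - P 1 * P 2) / 3))"
    by (simp add: r2 r3 r4 field_simps power2_eq_square power3_eq_cube power4_eq_xxxx)
  have "cmod ((a 2)\<^sup>2 - 2 * (a 3)\<^sup>2 + a 2 * a 4) \<le> cmod ((P 1)\<^sup>2) + (cmod ((P 2)\<^sup>2 / 2) + cmod ((P 1)\<^sup>2 * P 2 / 6) + cmod (P 1 ^ 4 / 3)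
      + cmod (- (P 1 * (P 3 - P 1 * P 2) / 3)))"
    unfolding B_eq by (intro order_trans[OF norm_triangle_ineq4] add_mono norm_triangle_mono order_refl)
  also have "\<dots> \<le> 4 + (4 / 2 + 8 / 6 + 16 / 3 + 4 / 3)"
  proof -
    have "cmod ((P 1)\<^sup>2) \<le> 4"
      using b1n[of 2] by (simp add: norm_power)
    moreover have "cmod ((P 2)\<^sup>2 / 2) \<le> 4 / 2"
      using power_mono[OF P(2) norm_ge_zero, of 2] by (simp add: norms)
    moreover have "cmod ((P 1)\<^sup>2 * P 2 / 6) \<le> 8 / 6"
      using mult_mono[OF b1n[of 2] P(2)] by (simp add: norms mult.commute)
    moreover have "cmod (P 1 ^ 4 / 3) \<le> 16 / 3"
      using b1n[of 4] by (simp add: norms)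
    moreover have "cmod (- (P 1 * (P 3 - P 1 * P 2) / 3)) \<le> 4 / 3"
      using mult_mono[OF P(1,4)] by (simp add: norms)
    ultimately show ?thesis by linarith
  qed
  finally have B: "cmod ((a 2)\<^sup>2 - 2 * (a 3)\<^sup>2 + a 2 * a 4) \<le> 14" by simp
  have "cmod (a 2 - a 4) * cmod ((a 2)\<^sup>2 - 2 * (a 3)\<^sup>2 + a 2 * a 4) \<le> 6 * 14"
    using A B by (intro mult_mono) auto
  then show ?thesis by (simp add: norm_mult)
qed

section \<open>Reduction to the unit disc\<close>

lemma norming_set_functionals:
  "norming_set {l :: 'a::complex_normed_vector \<Rightarrow> complex. bounded_clinear l \<and> (\<forall>y. cmod (l y) \<le> norm y)}"
    (is "norming_set ?\<Phi>")
  unfolding norming_set_def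
proof (intro conjI ballI allI impI)
  fix y :: 'a and B
  assume B: "\<forall>l\<in>?\<Phi>. cmod (l y) \<le> B"
  show "norm y \<le> B"
  proof (cases "y = 0")
    case True
    have "(\<lambda>_. 0) \<in> ?\<Phi>" by (simp add: bounded_clinear_def scaleC_complex_def)
    then show ?thesis using B True by force
  next
    case False
    then obtain l where l: "l \<in> norming_functionals y" using norming_functionals_nonempty by blast
    then have "l \<in> ?\<Phi>" using norming_functional_bound[OF l] by (simp add: norming_functionals_def)
    then have "cmod (l y) \<le> B" using B by blast
    then show ?thesis using l by (simp add: norming_functionals_def)
  qed
qed (simp_all add: bounded_clinear_def)

lemma fholomorphic_on_imp_gateaux:
  assumes F: "F fholomorphic_on S" and l: "bounded_clinear l"
  shows "gateaux_holomorphic_on (\<lambda>x. l (F x)) S"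
  unfolding gateaux_holomorphic_on_def
proof (intro allI holomorphic_onI)
  fix x v \<zeta> assume "\<zeta> \<in> {\<zeta>. x + \<zeta> *\<^sub>C v \<in> S}"
  then obtain L where L: "bounded_clinear L" "(F has_derivative L) (at (x + \<zeta> *\<^sub>C v))"
    using F by (auto simp: fholomorphic_on_def)
  have "((\<lambda>\<zeta>. x + \<zeta> *\<^sub>C v) has_derivative (\<lambda>\<eta>. \<eta> *\<^sub>C v)) (at \<zeta>)"
    using bounded_linear.has_derivative[OF bounded_linear_scaleC_left has_derivative_ident]
    by (intro has_derivative_eq_rhs[OF has_derivative_add[OF has_derivative_const]]) auto
  from has_derivative_compose[OF this L(2)]
  have "((\<lambda>\<zeta>. l (F (x + \<zeta> *\<^sub>C v))) has_derivative (\<lambda>\<eta>. l (L (\<eta> *\<^sub>C v)))) (at \<zeta>)"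
    using l by (intro bounded_linear.has_derivative[of l]) (auto simp: bounded_clinear_def)
  moreover have "l (L (\<eta> *\<^sub>C v)) = l (L v) * \<eta>" for \<eta>
    using l L(1) by (simp add: bounded_clinear_def scaleC_complex_def)
  ultimately have "((\<lambda>\<zeta>. l (F (x + \<zeta> *\<^sub>C v))) has_field_derivative l (L v)) (at \<zeta>)"
    by (simp add: has_field_derivative_def)
  then show "(\<lambda>\<zeta>. l (F (x + \<zeta> *\<^sub>C v))) field_differentiable at \<zeta> within {\<zeta>. x + \<zeta> *\<^sub>C v \<in> S}"
    by (metis field_differentiable_def has_field_derivative_at_within)
qed

text \<open>A holomorphic map may be unbounded on the unit ball, as the extremal map is. Continuity
  at 0 bounds it on a smaller ball, which is enough for derivatives at 0.\<close>

lemma fholomorphic_on_imp_weakly_holomorphic: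
  fixes F :: "'a::complex_normed_vector \<Rightarrow> 'b::complex_normed_vector"
  assumes F: "F fholomorphic_on ball 0 1"
  obtains r where "0 < r" "r \<le> 1"
    "weakly_holomorphic {l. bounded_clinear l \<and> (\<forall>y. cmod (l y) \<le> norm y)} r F"
proof -
  obtain L where "(F has_derivative L) (at 0)"
    using F unfolding fholomorphic_on_def by (meson centre_in_ball zero_less_one)
  then have "isCont F 0" by (rule has_derivative_continuous)
  then obtain d where d: "d > 0" "\<And>x. dist x 0 < d \<Longrightarrow> dist (F x) (F 0) < 1"
    unfolding continuous_at_eps_delta by (metis zero_less_one)
  define r where "r = min d 1"
  have r: "0 < r" "r \<le> 1" using d by (auto simp: r_def)
  have "norm (F x) \<le> 1 + norm (F 0)" if "norm x < r" for x
    using d(2)[of x] that norm_triangle_sub[of "F x" "F 0"] by (simp add: r_def dist_norm)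
  moreover have "gateaux_holomorphic_on (\<lambda>x. l (F x)) (ball 0 r)" if "bounded_clinear l" for l
  proof -
    have "ball 0 r \<subseteq> ball (0::'a) 1" using r by auto
    then have "{\<zeta>. x + \<zeta> *\<^sub>C v \<in> ball 0 r} \<subseteq> {\<zeta>. x + \<zeta> *\<^sub>C v \<in> ball 0 1}" for x v :: 'a by blast
    with fholomorphic_on_imp_gateaux[OF F that] show ?thesis
      unfolding gateaux_holomorphic_on_def by (meson holomorphic_on_subset)
  qed
  ultimately have "weakly_holomorphic {l. bounded_clinear l \<and> (\<forall>y. cmod (l y) \<le> norm y)} r F"
    unfolding weakly_holomorphic_def by blast
  with r show ?thesis using that by blast
qed

text \<open>Moving along real multiples of x keeps the chain rule within real linear operators, and
  the derivative of c along the real axis is already its complex derivative. The identity is proved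
  on an interval, so that it can be differentiated again.\<close>

lemma line_derivative:
  fixes G :: "'a::real_normed_vector \<Rightarrow> 'b::real_normed_vector"
  assumes der: "\<And>y. norm y < r \<Longrightarrow> (G has_derivative fderiv G y) (at y)"
    and \<phi>: "bounded_linear \<phi>" and c: "c holomorphic_on ball 0 r" and x: "norm x = 1"
    and eq: "\<And>t. \<bar>t\<bar> < r \<Longrightarrow> \<phi> (G (t *\<^sub>R x)) = c (of_real t)" and t: "\<bar>t\<bar> < r"
  shows "\<phi> (fderiv G (t *\<^sub>R x) x) = deriv c (of_real t)"
proof -
  have "((\<lambda>s. s *\<^sub>R x) has_derivative (\<lambda>s. s *\<^sub>R x)) (at t)"
    by (auto intro!: derivative_eq_intros)
  from has_derivative_compose[OF this der]
  have "((\<lambda>s. G (s *\<^sub>R x)) has_derivative (\<lambda>s. fderiv G (t *\<^sub>R x) (s *\<^sub>R x))) (at t)"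
    using t x by simp
  from bounded_linear.has_derivative[OF \<phi> this]
  have 1: "((\<lambda>s. \<phi> (G (s *\<^sub>R x))) has_vector_derivative \<phi> (fderiv G (t *\<^sub>R x) x)) (at t)"
    by (simp add: has_vector_derivative_def blinfun.scaleR_right
        linear_cmul[OF bounded_linear.linear[OF \<phi>]])
  have "(c has_field_derivative deriv c (of_real t)) (at (of_real t))"
    using t by (intro holomorphic_derivI[OF c]) auto
  then have "((\<lambda>s. c (of_real s)) has_vector_derivative deriv c (of_real t)) (at t)"
    by (rule has_vector_derivative_real_field)
  then have 2: "((\<lambda>s. \<phi> (G (s *\<^sub>R x))) has_vector_derivative deriv c (of_real t)) (at t)"
    by (rule has_vector_derivative_transform_within_open[where S = "{-r<..<r}"]) (use t eq in auto)
  show ?thesis by (rule vector_derivative_unique_at[OF 1 2])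
qed

lemma fderiv_iterates_on_line:
  fixes F :: "'a::complex_banach \<Rightarrow> 'a"
  assumes F: "F fholomorphic_on ball 0 1" and l: "bounded_clinear l" and x: "norm x = 1"
  defines "c \<equiv> \<lambda>\<zeta>. l (F (\<zeta> *\<^sub>C x))"
  shows "l (fderiv F 0 x) = deriv c 0"
    and "l (fderiv (fderiv F) 0 x x) = (deriv ^^ 2) c 0"
    and "l (fderiv (fderiv (fderiv F)) 0 x x x) = (deriv ^^ 3) c 0"
    and "l (fderiv (fderiv (fderiv (fderiv F))) 0 x x x x) = (deriv ^^ 4) c 0"
proof -
  let ?\<Phi> = "{l :: 'a \<Rightarrow> complex. bounded_clinear l \<and> (\<forall>y. cmod (l y) \<le> norm y)}"
  obtain r where r: "0 < r" "r \<le> 1" and w0: "weakly_holomorphic ?\<Phi> r F"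
    using fholomorphic_on_imp_weakly_holomorphic[OF F] by blast
  note n0 = norming_set_functionals[where 'a = 'a]
  note n1 = norming_set_lift[OF n0, where 'a = 'a]
  note n2 = norming_set_lift[OF n1, where 'a = 'a]
  note n3 = norming_set_lift[OF n2, where 'a = 'a]
  note w1 = weakly_holomorphic_derivative(2)[OF n0 w0 r(1)]
  have r1: "0 < r / 2" "0 < r / 2 / 2" "0 < r / 2 / 2 / 2" using r by auto
  note w2 = weakly_holomorphic_derivative(2)[OF n1 w1 r1(1)]
  note w3 = weakly_holomorphic_derivative(2)[OF n2 w2 r1(2)]
  \<comment> \<open>Each of the four differentiations halves the radius.\<close>
  define e where "e = r / 16"
  have e: "0 < e" "e < 1" "e \<le> r / 2" "e \<le> r / 2 / 2" "e \<le> r / 2 / 2 / 2" "e \<le> r / 2 / 2 / 2 / 2"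
    using r by (auto simp: e_def)
  note d0 = weakly_holomorphic_derivative(1)[OF n0 w0 r(1) order_less_le_trans[OF _ e(3)]]
  note d1 = weakly_holomorphic_derivative(1)[OF n1 w1 r1(1) order_less_le_trans[OF _ e(4)]]
  note d2 = weakly_holomorphic_derivative(1)[OF n2 w2 r1(2) order_less_le_trans[OF _ e(5)]]
  note d3 = weakly_holomorphic_derivative(1)[OF n3 w3 r1(3) order_less_le_trans[OF _ e(6)]]
  have "(\<lambda>\<zeta>. l (F (0 + \<zeta> *\<^sub>C x))) holomorphic_on {\<zeta>. 0 + \<zeta> *\<^sub>C x \<in> ball 0 1}"
    using fholomorphic_on_imp_gateaux[OF F l] unfolding gateaux_holomorphic_on_def by blast
  then have "c holomorphic_on {\<zeta>. \<zeta> *\<^sub>C x \<in> ball 0 1}"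
    by (simp only: add_0 c_def)
  then have "c holomorphic_on ball 0 e"
    by (rule holomorphic_on_subset) (use e x in \<open>auto simp: norm_scaleC\<close>)
  then have hol: "(deriv ^^ k) c holomorphic_on ball 0 e" for k
    by (rule holomorphic_higher_deriv) simp
  have bl: "bounded_linear l" using l by (simp add: bounded_clinear_def)
  have b1: "bounded_linear (\<lambda>T::'a \<Rightarrow>\<^sub>L 'a. l (T x))"
    by (rule bounded_linear_compose[OF bl blinfun.bounded_linear_left])
  have b2: "bounded_linear (\<lambda>T::'a \<Rightarrow>\<^sub>L ('a \<Rightarrow>\<^sub>L 'a). l (T x x))"
    by (rule bounded_linear_compose[OF b1 blinfun.bounded_linear_left])
  have b3: "bounded_linear (\<lambda>T::'a \<Rightarrow>\<^sub>L ('a \<Rightarrow>\<^sub>L ('a \<Rightarrow>\<^sub>L 'a)). l (T x x x))"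
    by (rule bounded_linear_compose[OF b2 blinfun.bounded_linear_left])
  have s0: "l (F (t *\<^sub>R x)) = (deriv ^^ 0) c (of_real t)" for t
    by (simp add: c_def scaleR_scaleC)
  have s1: "l (fderiv F (t *\<^sub>R x) x) = (deriv ^^ 1) c (of_real t)" if "\<bar>t\<bar> < e" for t
    using line_derivative[OF d0 bl hol x s0 that] by simp
  have s2: "l (fderiv (fderiv F) (t *\<^sub>R x) x x) = (deriv ^^ 2) c (of_real t)" if "\<bar>t\<bar> < e" for t
    using line_derivative[OF d1 b1 hol x s1 that] by (simp add: numeral_2_eq_2)
  have s3: "l (fderiv (fderiv (fderiv F)) (t *\<^sub>R x) x x x) = (deriv ^^ 3) c (of_real t)" if "\<bar>t\<bar> < e" for t
    using line_derivative[OF d2 b2 hol x s2 that] by (simp add: numeral_2_eq_2 numeral_3_eq_3)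
  have s4: "l (fderiv (fderiv (fderiv (fderiv F))) (t *\<^sub>R x) x x x x) = (deriv ^^ 4) c (of_real t)"
    if "\<bar>t\<bar> < e" for t
    using line_derivative[OF d3 b3 hol x s3 that] by (simp add: eval_nat_numeral)
  show "l (fderiv F 0 x) = deriv c 0"
    and "l (fderiv (fderiv F) 0 x x) = (deriv ^^ 2) c 0"
    and "l (fderiv (fderiv (fderiv F)) 0 x x x) = (deriv ^^ 3) c 0"
    and "l (fderiv (fderiv (fderiv (fderiv F))) 0 x x x x) = (deriv ^^ 4) c 0"
    using s1[of 0] s2[of 0] s3[of 0] s4[of 0] e by simp_all
qed

lemma A_eq_taylor_coeff:
  fixes F :: "'a::complex_banach \<Rightarrow> 'a"
  assumes F: "F fholomorphic_on ball 0 1" and l: "bounded_clinear l" and z: "z \<noteq> 0"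
  defines "c \<equiv> \<lambda>\<zeta>. l (F (\<zeta> *\<^sub>C ((1 / norm z) *\<^sub>R z)))"
  shows "A2 F z l = fps_nth (fps_expansion c 0) 2"
    and "A3 F z l = fps_nth (fps_expansion c 0) 3"
    and "A4 F z l = fps_nth (fps_expansion c 0) 4"
proof -
  define x where "x = (1 / norm z) *\<^sub>R z"
  define s where "s = norm z"
  have x: "norm x = 1" using z by (simp add: x_def)
  have s: "s > 0" "norm z = s" "z = s *\<^sub>R x" using z by (simp_all add: x_def s_def)
  have lR: "l (a *\<^sub>R y) = of_real a * l y" for a y
    using l by (simp add: bounded_clinear_def linear_cmul bounded_linear.linear scaleR_conv_of_real)
  note D = fderiv_iterates_on_line[OF F l x, folded c_def[folded x_def]]
  show "A2 F z l = fps_nth (fps_expansion c 0) 2"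
    using s(1) D(2) unfolding A2_def s(2) unfolding s(3)
    by (simp add: blinfun.scaleR_left blinfun.scaleR_right lR fps_expansion_def power2_eq_square)
  show "A3 F z l = fps_nth (fps_expansion c 0) 3"
    using s(1) D(3) unfolding A3_def s(2) unfolding s(3)
    by (simp add: blinfun.scaleR_left blinfun.scaleR_right lR fps_expansion_def power3_eq_cube)
  show "A4 F z l = fps_nth (fps_expansion c 0) 4"
    using s(1) D(4) unfolding A4_def s(2) unfolding s(3)
    by (simp add: blinfun.scaleR_left blinfun.scaleR_right lR fps_expansion_def power4_eq_xxxx)
qed

section \<open>The restriction of a starlike map to a complex line\<close>

lemma starlike_map_bound:
  fixes F :: "'a::complex_banach \<Rightarrow> 'a"
  assumes Ff: "\<And>z. z \<in> ball 0 1 \<Longrightarrow> F z = f z *\<^sub>C z" and F: "F \<in> starlike_maps"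
    and z: "z \<noteq> 0" and l: "l \<in> norming_functionals z"
  shows "cmod ((A2 F z l - A4 F z l) * ((A2 F z l)\<^sup>2 - 2 * (A3 F z l)\<^sup>2 + A2 F z l * A4 F z l)) \<le> 84"
proof -
  define x where "x = (1 / norm z) *\<^sub>R z"
  define h where "h \<zeta> = l (F (\<zeta> *\<^sub>C x))" for \<zeta>
  have x: "norm x = 1" using z by (simp add: x_def)
  have Fhol: "F fholomorphic_on ball 0 1" and Finj: "inj_on F (ball 0 1)" and "normalized F"
    and Fstar: "\<And>w t. w \<in> F ` ball 0 1 \<Longrightarrow> t \<in> {0..1} \<Longrightarrow> t *\<^sub>R w \<in> F ` ball 0 1"
    using F by (auto simp: starlike_maps_def biholomorphic_on_def)
  then have F0: "F 0 = 0" and F1: "(F has_derivative (\<lambda>v. v)) (at 0)"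
    by (auto simp: normalized_def)
  have lc: "bounded_clinear l" and lz: "l z = of_real (norm z)"
    using l by (auto simp: norming_functionals_def)
  have lC: "l (c *\<^sub>C y) = c * l y" for c y
    using lc by (simp add: bounded_clinear_def scaleC_complex_def)
  have lx: "l x = 1" using z by (simp add: x_def scaleR_scaleC lC lz)
  have ball: "\<zeta> *\<^sub>C x \<in> ball 0 1 \<longleftrightarrow> \<zeta> \<in> ball 0 1" for \<zeta>
    using x by (simp add: norm_scaleC)
  have Fx: "F (\<zeta> *\<^sub>C x) = h \<zeta> *\<^sub>C x" if "\<zeta> \<in> ball 0 1" for \<zeta>
    using Ff[of "\<zeta> *\<^sub>C x"] that ball by (simp add: h_def lC lx scaleC_scaleC)
  have h_hol: "h holomorphic_on ball 0 1"
  proof -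
    have "(\<lambda>\<zeta>. l (F (0 + \<zeta> *\<^sub>C x))) holomorphic_on {\<zeta>. 0 + \<zeta> *\<^sub>C x \<in> ball 0 1}"
      using fholomorphic_on_imp_gateaux[OF Fhol lc] unfolding gateaux_holomorphic_on_def by blast
    then show ?thesis
      by (simp add: h_def[abs_def] x norm_scaleC ball_def)
  qed
  have h_inj: "inj_on h (ball 0 1)"
  proof (rule inj_onI)
    fix a b assume ab: "a \<in> ball 0 1" "b \<in> ball 0 1" "h a = h b"
    then have "F (a *\<^sub>C x) = F (b *\<^sub>C x)" by (simp add: Fx)
    then have "a *\<^sub>C x = b *\<^sub>C x" using Finj ab ball by (auto simp: inj_on_def)
    then have "l (a *\<^sub>C x) = l (b *\<^sub>C x)" by simp
    then show "a = b" by (simp add: lC lx)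
  qed
  have h0: "h 0 = 0" using Fx[of 0] by (simp add: F0 h_def) (metis lC mult_zero_left scaleC_zero_left)
  have "fderiv F 0 = id_blinfun" using F1 by (intro fderiv_eqI) simp
  then have h1: "deriv h 0 = 1"
    using fderiv_iterates_on_line(1)[OF Fhol lc x] lx by (simp add: h_def[abs_def])
  have star: "of_real t * h \<zeta> \<in> h ` ball 0 1" if "\<zeta> \<in> ball 0 1" "t \<in> {0..1}" for \<zeta> t
  proof (cases "of_real t * h \<zeta> = 0")
    case True
    then show ?thesis using h0 by (metis centre_in_ball imageI zero_less_one)
  next
    case False
    have "t *\<^sub>R F (\<zeta> *\<^sub>C x) \<in> F ` ball 0 1" using that ball by (intro Fstar) auto
    then obtain w where w: "w \<in> ball 0 1" "t *\<^sub>R F (\<zeta> *\<^sub>C x) = F w" by auto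
    then have eq: "(of_real t * h \<zeta>) *\<^sub>C x = f w *\<^sub>C w"
      using Fx[OF that(1)] Ff[OF w(1)] by (simp add: scaleR_scaleC scaleC_scaleC)
    have "f w \<noteq> 0"
    proof
      assume "f w = 0"
      then have "l ((of_real t * h \<zeta>) *\<^sub>C x) = l (0 *\<^sub>C w)" using eq by simp
      then show False using False by (simp only: lC lx) simp
    qed
    define \<eta> where "\<eta> = (of_real t * h \<zeta>) / f w"
    have "w = (1 / f w) *\<^sub>C (f w *\<^sub>C w)" using \<open>f w \<noteq> 0\<close> by (simp add: scaleC_scaleC scaleC_one)
    also have "\<dots> = \<eta> *\<^sub>C x" by (simp add: \<eta>_def scaleC_scaleC flip: eq)
    finally have w\<eta>: "w = \<eta> *\<^sub>C x" .
    then have \<eta>: "\<eta> \<in> ball 0 1" using w(1) ball by simp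
    have "l (t *\<^sub>R F (\<zeta> *\<^sub>C x)) = h \<eta>" using w(2) w\<eta> by (simp add: h_def)
    then have "of_real t * h \<zeta> = h \<eta>" by (simp add: scaleR_scaleC lC h_def)
    then show ?thesis using \<eta> by blast
  qed
  show ?thesis
    using starlike_coeff_bound[OF h_hol h_inj h0 h1 star]
    unfolding A_eq_taylor_coeff[OF Fhol lc z] h_def[abs_def] x_def .
qed

section \<open>Sharpness\<close>

lemma bounded_bilinear_scaleC:
  "bounded_bilinear (\<lambda>c (x::'a::complex_normed_vector). c *\<^sub>C x)"
proof
  show "\<exists>K. \<forall>c (x::'a). norm (c *\<^sub>C x) \<le> norm c * norm x * K"
    by (rule exI[of _ 1]) (simp add: norm_scaleC)
qed (simp_all add: scaleC_add_left scaleC_add_right scaleC_scaleR_commute scaleR_conv_of_real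
      scaleR_scaleC[where 'a = 'a] scaleC_scaleC mult.commute)

lemma fholomorphic_on_compose_functional:
  assumes u: "u holomorphic_on T" "open T" and m: "bounded_clinear m"
    and S: "open S" "\<And>y. y \<in> S \<Longrightarrow> m y \<in> T"
  shows "(\<lambda>y. u (m y)) fholomorphic_on S"
  unfolding fholomorphic_on_def
proof (intro conjI ballI S)
  fix y assume "y \<in> S"
  then have "(u has_derivative (\<lambda>v. deriv u (m y) * v)) (at (m y))"
    using holomorphic_derivI[OF u S(2)] by (simp add: has_field_derivative_def)
  moreover have ml: "bounded_linear m" and mC: "\<And>c x. m (c *\<^sub>C x) = c * m x"
    using m by (auto simp: bounded_clinear_def scaleC_complex_def)
  ultimately have "((\<lambda>y. u (m y)) has_derivative (\<lambda>v. deriv u (m y) * m v)) (at y)"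
    using has_derivative_compose[OF bounded_linear_imp_has_derivative[OF ml]] by blast
  moreover have "bounded_clinear (\<lambda>v. deriv u (m y) * m v)"
    using bounded_linear_const_mult[OF ml] by (simp add: bounded_clinear_def scaleC_complex_def mC)
  ultimately show "\<exists>L. bounded_clinear L \<and> ((\<lambda>y. u (m y)) has_derivative L) (at y)" by blast
qed

lemma has_derivative_scaleC_self:
  assumes "(u has_derivative u') (at y)"
  shows "((\<lambda>y. u y *\<^sub>C y) has_derivative (\<lambda>v. u y *\<^sub>C v + u' v *\<^sub>C y)) (at (y::'a::complex_normed_vector))"
  by (rule bounded_bilinear.FDERIV[OF bounded_bilinear_scaleC assms has_derivative_ident])

lemma fholomorphic_on_scaleC_self:
  assumes "u fholomorphic_on S"
  shows "(\<lambda>y. u y *\<^sub>C y) fholomorphic_on S"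
  unfolding fholomorphic_on_def
proof (intro conjI ballI)
  show "open S" using assms by (simp add: fholomorphic_on_def)
  fix y assume "y \<in> S"
  then obtain u' where u': "bounded_clinear u'" "(u has_derivative u') (at y)"
    using assms unfolding fholomorphic_on_def by blast
  note d = has_derivative_scaleC_self[OF u'(2)]
  moreover have "bounded_clinear (\<lambda>v. u y *\<^sub>C v + u' v *\<^sub>C y)"
    using has_derivative_bounded_linear[OF d] u'(1)
    by (auto simp: bounded_clinear_def scaleC_complex_def scaleC_add_right scaleC_scaleC mult.commute)
  ultimately show "\<exists>L. bounded_clinear L \<and> ((\<lambda>y. u y *\<^sub>C y) has_derivative L) (at y)" by blast
qed

section \<open>The Koebe function of the disc\<close>

definition koebe :: "complex \<Rightarrow> complex" where
  "koebe z = z / (1 - z)\<^sup>2"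

lemma ball_neq_one: "z \<in> ball 0 1 \<Longrightarrow> 1 - z \<noteq> (0::complex)"
  by auto

lemma koebe_holomorphic: "koebe holomorphic_on ball 0 1"
  unfolding koebe_def[abs_def] by (intro holomorphic_intros) (auto dest: ball_neq_one)

lemma koebe_inj: "inj_on koebe (ball 0 1)"
proof (rule inj_onI)
  fix a b :: complex assume ab: "a \<in> ball 0 1" "b \<in> ball 0 1" "koebe a = koebe b"
  have "a * (1 - b)\<^sup>2 = b * (1 - a)\<^sup>2"
    using ab ball_neq_one[of a] ball_neq_one[of b] by (simp add: koebe_def frac_eq_eq)
  then have "(a - b) * (1 - a * b) = 0" by (simp add: power2_eq_square algebra_simps)
  moreover have "a * b \<noteq> 1"
  proof
    assume "a * b = 1"
    then have "cmod a * cmod b = 1" by (simp flip: norm_mult)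
    moreover have "cmod a * cmod b < 1 * 1" using ab by (intro mult_strict_mono) auto
    ultimately show False by simp
  qed
  ultimately show "a = b" by auto
qed

text \<open>In the half-plane coordinate \<open>q = (1 + a) / (1 - a)\<close> the Koebe function is \<open>(q\<^sup>2 - 1) / 4\<close>,
  so scaling its value by \<open>t\<close> moves \<open>q\<^sup>2\<close> towards \<open>1\<close> inside the plane slit along \<open>(-\<infinity>, 0]\<close>.\<close>

lemma koebe_starlike:
  assumes a: "a \<in> ball 0 1" and t: "t \<in> {0..1}"
  shows "of_real t * koebe a \<in> koebe ` ball 0 1"
proof -
  have a1: "1 - a \<noteq> 0" by (rule ball_neq_one[OF a])
  define q where "q = (1 + a) / (1 - a)"
  have q_pos: "Re q > 0"
  proof -
    have "q = (1 + a) * cnj (1 - a) / of_real ((cmod (1 - a))\<^sup>2)"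
    proof -
      have "cnj (1 - a) \<noteq> 0" using a1 by (simp only: complex_cnj_zero_iff) simp
      then show ?thesis
        unfolding complex_norm_square q_def by (rule mult_divide_mult_cancel_right[symmetric])
    qed
    then have "Re q = Re ((1 + a) * cnj (1 - a)) / (cmod (1 - a))\<^sup>2"
      by (simp only: Re_divide_of_real)
    also have "Re ((1 + a) * cnj (1 - a)) = 1 - (cmod a)\<^sup>2"
      by (simp only: cmod_power2) (simp add: power2_eq_square algebra_simps)
    also have "(1 - (cmod a)\<^sup>2) / (cmod (1 - a))\<^sup>2 > 0"
      using a a1 by (intro divide_pos_pos) (auto simp: power_less_one_iff abs_square_less_1)
    finally show ?thesis .
  qed
  define s where "s = csqrt (of_real (1 - t) + of_real t * q\<^sup>2)"
  \<comment> \<open>If Re s were 0, s^2 would be a nonpositive real. For t > 0 this makes q real,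
    and then the right-hand side is positive; for t = 0 it is 1.\<close>
  have s2: "s\<^sup>2 = of_real (1 - t) + of_real t * q\<^sup>2" by (simp add: s_def)
  have "Re s \<noteq> 0"
  proof
    assume s0: "Re s = 0"
    have re: "(1 - t) + t * ((Re q)\<^sup>2 - (Im q)\<^sup>2) = - (Im s)\<^sup>2"
      using arg_cong[OF s2, of Re] s0 by (simp add: power2_eq_square)
    have im: "t * (2 * Re q * Im q) = 0"
      using arg_cong[OF s2, of Im] s0 by (simp add: power2_eq_square algebra_simps)
    show False
    proof (cases "t = 0")
      case True
      then have "1 = - (Im s)\<^sup>2" using re by simp
      then show False using zero_le_power2[of "Im s"] by linarith
    next
      case False
      then have "Im q = 0" using im q_pos by simp
      then have "(1 - t) + t * (Re q)\<^sup>2 = - (Im s)\<^sup>2" using re by simp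
      moreover have "t * (Re q)\<^sup>2 > 0" using False t q_pos by simp
      moreover have "1 - t \<ge> 0" using t by simp
      ultimately show False using zero_le_power2[of "Im s"] by linarith
    qed
  qed
  moreover have "Re s \<ge> 0" using csqrt_principal[of "of_real (1 - t) + of_real t * q\<^sup>2"] by (auto simp: s_def)
  ultimately have s_pos: "Re s > 0" by simp
  have s1: "s + 1 \<noteq> 0"
  proof
    assume "s + 1 = 0"
    then have "Re (s + 1) = 0" by simp
    then show False using s_pos by simp
  qed
  \<comment> \<open>The inverse of the half-plane coordinate: Re s > 0 places s nearer to 1 than to
    -1, so b lies in the disc.\<close>
  define b where "b = (s - 1) / (s + 1)"
  have "(cmod (s - 1))\<^sup>2 < (cmod (s + 1))\<^sup>2"
    unfolding cmod_power2 using s_pos by (simp add: power2_eq_square algebra_simps)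
  then have "cmod (s - 1) < cmod (s + 1)" by (rule power_less_imp_less_base) simp
  then have b: "b \<in> ball 0 1" using s1 by (simp add: b_def norm_divide)
  have b1: "1 - b = 2 / (s + 1)" using s1 by (simp add: b_def field_simps)
  have "koebe b = (s\<^sup>2 - 1) / 4"
  proof -
    have "(x / d) / (2 / d)\<^sup>2 = x * d / 4" if "d \<noteq> 0" for x d :: complex
      using that by (simp add: power2_eq_square)
    from this[OF s1, of "s - 1"] show ?thesis
      unfolding koebe_def b1 unfolding b_def by (simp add: power2_eq_square algebra_simps)
  qed
  also have "s\<^sup>2 - 1 = of_real t * (q\<^sup>2 - 1)" by (simp add: s2 algebra_simps)
  also have "q\<^sup>2 - 1 = 4 * koebe a"
  proof -
    have "q\<^sup>2 - 1 = ((1 + a)\<^sup>2 - (1 - a)\<^sup>2) / (1 - a)\<^sup>2"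
      using a1 by (simp add: q_def power_divide diff_divide_distrib)
    also have "(1 + a)\<^sup>2 - (1 - a)\<^sup>2 = 4 * a" by (simp add: power2_eq_square algebra_simps)
    finally show ?thesis by (simp add: koebe_def)
  qed
  finally have "of_real t * koebe a = koebe b" by simp
  then show ?thesis using b by blast
qed

text \<open>Since m(F y) = koebe(m y), the number m y can be read off from w = F y by inverting the
  Koebe function in one variable. The factor (1 - m y)^2 is then known, and multiplying w by it
  inverts F.\<close>

lemma koebe_lift_starlike:
  fixes m :: "'a::complex_normed_vector \<Rightarrow> complex"
  assumes m: "bounded_clinear m" and m_le: "\<And>y. cmod (m y) \<le> norm y"
  shows "(\<lambda>y. 1 / (1 - m y)\<^sup>2) fholomorphic_on ball 0 1"
    and "(\<lambda>y. (1 / (1 - m y)\<^sup>2) *\<^sub>C y) \<in> starlike_maps"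
proof -
  define F where "F y = (1 / (1 - m y)\<^sup>2) *\<^sub>C y" for y
  have ml: "bounded_linear m" and mC: "\<And>c x. m (c *\<^sub>C x) = c * m x"
    using m by (auto simp: bounded_clinear_def scaleC_complex_def)
  have mR: "m (t *\<^sub>R x) = of_real t * m x" for t x by (simp add: scaleR_scaleC mC)
  have m_ball: "m y \<in> ball 0 1" if "y \<in> ball 0 1" for y
    using m_le[of y] that by simp
  have mF: "m (F y) = koebe (m y)" for y by (simp add: F_def mC koebe_def)
  obtain k where k: "k holomorphic_on koebe ` ball 0 1" "\<And>z. z \<in> ball 0 1 \<Longrightarrow> k (koebe z) = z"
    by (rule holomorphic_has_inverse[OF koebe_holomorphic open_ball koebe_inj]) (rule that)
  have k_open: "open (koebe ` ball 0 1)"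
    by (rule open_mapping_thm3[OF koebe_holomorphic open_ball koebe_inj])
  define G where "G w = ((1 - k (m w))\<^sup>2) *\<^sub>C w" for w
  define V where "V = {w. m w \<in> koebe ` ball 0 1}"
  have V_open: "open V"
    using open_vimage[OF k_open, of m] linear_continuous_on[OF ml] by (simp add: V_def vimage_def)
  have G_hol: "G fholomorphic_on V"
    unfolding G_def
    by (intro fholomorphic_on_scaleC_self fholomorphic_on_compose_functional[OF _ k_open m V_open,
          where u = "\<lambda>z. (1 - k z)\<^sup>2"] holomorphic_intros k) (simp add: V_def)
  have u_hol: "(\<lambda>y. 1 / (1 - m y)\<^sup>2) fholomorphic_on ball 0 1"
    using m_ball
    by (intro fholomorphic_on_compose_functional[where u = "\<lambda>z. 1 / (1 - z)\<^sup>2" and T = "ball 0 1",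
          OF _ open_ball m open_ball]
        holomorphic_intros) (auto dest: ball_neq_one)
  then show "(\<lambda>y. 1 / (1 - m y)\<^sup>2) fholomorphic_on ball 0 1" .
  have F_hol: "F fholomorphic_on ball 0 1"
    unfolding F_def by (rule fholomorphic_on_scaleC_self[OF u_hol])
  have GF: "G (F y) = y" if "y \<in> ball 0 1" for y
    using ball_neq_one[OF m_ball[OF that]] k(2)[OF m_ball[OF that]]
    by (simp add: G_def mF) (simp add: F_def scaleC_scaleC scaleC_one)
  have F_inj: "inj_on F (ball 0 1)" by (rule inj_on_inverseI[where g = G]) (rule GF)
  \<comment> \<open>Membership in V controls only the value of m, not the norm, so the image is cut
    out of V by requiring the candidate preimage \<open>G w\<close> to lie in the ball.\<close>
  have image: "F ` ball 0 1 = V \<inter> {w. G w \<in> ball 0 1}"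
  proof (intro equalityI subsetI)
    fix w assume "w \<in> F ` ball 0 1"
    then show "w \<in> V \<inter> {w. G w \<in> ball 0 1}" using GF m_ball mF by (auto simp: V_def)
  next
    fix w assume w: "w \<in> V \<inter> {w. G w \<in> ball 0 1}"
    then obtain \<zeta> where \<zeta>: "\<zeta> \<in> ball 0 1" "m w = koebe \<zeta>" by (auto simp: V_def)
    have nz: "1 - \<zeta> \<noteq> 0" by (rule ball_neq_one[OF \<zeta>(1)])
    have Gw: "G w = ((1 - \<zeta>)\<^sup>2) *\<^sub>C w" using k(2)[OF \<zeta>(1)] \<zeta>(2) by (simp add: G_def)
    have "m (G w) = \<zeta>" using nz by (simp add: Gw mC \<zeta>(2) koebe_def)
    then have "F (G w) = w" using nz by (simp add: F_def Gw scaleC_scaleC scaleC_one)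
    then show "w \<in> F ` ball 0 1" using w by force
  qed
  have continuous_if_fhol: "continuous_on S H" if "H fholomorphic_on S" for H :: "'a \<Rightarrow> 'a" and S
    using that unfolding fholomorphic_on_def
    by (metis continuous_at_imp_continuous_on has_derivative_continuous)
  have F_open: "open (F ` ball 0 1)"
  proof -
    have "open (V \<inter> G -` ball 0 1)"
      by (rule continuous_open_preimage[OF continuous_if_fhol[OF G_hol] V_open open_ball])
    then show ?thesis by (simp add: image vimage_def)
  qed
  have inv_hol: "inv_into (ball 0 1) F fholomorphic_on F ` ball 0 1"
    unfolding fholomorphic_on_def
  proof (intro conjI ballI F_open)
    fix w assume w: "w \<in> F ` ball 0 1"
    then have "w \<in> V" unfolding image by blast
    then obtain L where L: "bounded_clinear L" "(G has_derivative L) (at w)"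
      using G_hol unfolding fholomorphic_on_def by blast
    have "G x = inv_into (ball 0 1) F x" if "x \<in> F ` ball 0 1" for x
      using that GF F_inj by auto
    then have "(inv_into (ball 0 1) F has_derivative L) (at w)"
      using has_derivative_transform_within_open[OF L(2) F_open w] by blast
    then show "\<exists>L. bounded_clinear L \<and> (inv_into (ball 0 1) F has_derivative L) (at w)"
      using L(1) by blast
  qed
  have "connected (F ` ball 0 1)"
    by (intro connected_continuous_image continuous_if_fhol F_hol convex_connected convex_ball)
  then have biholo: "F biholomorphic_on ball 0 1"
    unfolding biholomorphic_on_def using F_hol F_inj F_open inv_hol by blast
  have m0: "m 0 = 0" using m_le[of 0] by simp
  have norm: "normalized F"
    unfolding normalized_def
  proof
    show "F 0 = 0" by (simp add: F_def)
    obtain u' where "((\<lambda>y. 1 / (1 - m y)\<^sup>2) has_derivative u') (at 0)"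
      using u_hol unfolding fholomorphic_on_def by (meson centre_in_ball zero_less_one)
    from has_derivative_scaleC_self[OF this] show "(F has_derivative (\<lambda>v. v)) (at 0)"
      by (simp add: F_def[abs_def] m0 scaleC_one)
  qed
  have "t *\<^sub>R w \<in> F ` ball 0 1" if "w \<in> F ` ball 0 1" and t: "t \<in> {0..1}" for w t
  proof -
    obtain y where y: "y \<in> ball 0 1" "w = F y" using \<open>w \<in> F ` ball 0 1\<close> by blast
    have my: "m y \<in> ball 0 1" by (rule m_ball[OF y(1)])
    have mtw: "m (t *\<^sub>R w) = of_real t * koebe (m y)" by (simp add: mR y(2) mF)
    obtain \<zeta> where \<zeta>: "\<zeta> \<in> ball 0 1" "koebe \<zeta> = of_real t * koebe (m y)"
      using koebe_starlike[OF my t] by auto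
    have le: "cmod \<zeta> \<le> cmod (m y)"
      by (rule starlike_preimage_norm_le[OF koebe_holomorphic koebe_inj _ koebe_starlike \<zeta>(1) my t \<zeta>(2)])
         (simp add: koebe_def)
    \<comment> \<open>The preimage of t w turns out to be d y, so starlikeness amounts to
      \<open>cmod d \<le> 1\<close>. If m y is nonzero, d is the quotient of \<open>\<zeta>\<close>
      by m y and the Schwarz bound applies; if m y = 0, then d = t.\<close>
    define d where "d = (1 - \<zeta>)\<^sup>2 * of_real t / (1 - m y)\<^sup>2"
    have "d * m y = (1 - \<zeta>)\<^sup>2 * koebe \<zeta>" unfolding d_def \<zeta>(2) by (simp add: koebe_def)
    also have "\<dots> = \<zeta>" using ball_neq_one[OF \<zeta>(1)] by (simp add: koebe_def)
    finally have d\<zeta>: "d * m y = \<zeta>" .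
    have "cmod d \<le> 1"
    proof (cases "m y = 0")
      case True
      then have "\<zeta> = 0" using d\<zeta> by simp
      then show ?thesis using True t by (simp add: d_def)
    next
      case False
      have "cmod d * cmod (m y) \<le> 1 * cmod (m y)" using le by (simp flip: d\<zeta> norm_mult)
      then show ?thesis using False by (simp only: mult_le_cancel_right) auto
    qed
    have "G (t *\<^sub>R w) = d *\<^sub>C y"
      using k(2)[OF \<zeta>(1)] unfolding G_def mtw \<zeta>(2)[symmetric]
      by (simp add: y(2) F_def scaleR_scaleC scaleC_scaleC d_def)
    then have "norm (G (t *\<^sub>R w)) \<le> norm y"
      using \<open>cmod d \<le> 1\<close> by (simp add: norm_scaleC mult_left_le_one_le)
    then have "G (t *\<^sub>R w) \<in> ball 0 1" using y(1) by simp
    moreover have "t *\<^sub>R w \<in> V" using \<zeta> by (auto simp: V_def mtw simp flip: \<zeta>(2))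
    ultimately show ?thesis unfolding image by blast
  qed
  then show "(\<lambda>y. (1 / (1 - m y)\<^sup>2) *\<^sub>C y) \<in> starlike_maps"
    using biholo norm by (simp add: starlike_maps_def F_def[abs_def])
qed

text \<open>Expanding (1 - i z)^2 = 1 - 2 i z - z^2 and clearing the denominator gives a recurrence
  for the coefficients.\<close>

lemma rotated_koebe_coeffs:
  assumes c: "\<And>\<zeta>. \<zeta> \<in> ball 0 1 \<Longrightarrow> c \<zeta> = \<zeta> / (1 - \<i> * \<zeta>)\<^sup>2"
  defines "C \<equiv> fps_nth (fps_expansion c 0)"
  shows "C 2 = 2 * \<i>" "C 3 = -3" "C 4 = -4 * \<i>"
proof -
  have nz: "1 - \<i> * \<zeta> \<noteq> 0" if "\<zeta> \<in> ball 0 1" for \<zeta>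
    using ball_neq_one[of "\<i> * \<zeta>"] that by (simp add: norm_mult)
  have "(\<lambda>\<zeta>. \<zeta> / (1 - \<i> * \<zeta>)\<^sup>2) holomorphic_on ball 0 1"
    by (intro holomorphic_intros) (use nz in auto)
  then have "c holomorphic_on ball 0 1"
    by (rule holomorphic_transform) (simp add: c)
  then have e: "c has_fps_expansion fps_expansion c 0"
    by (intro has_fps_expansion_fps_expansion[of "ball 0 1"]) auto
  let ?R = "fps_X + fps_const (2 * \<i>) * (fps_X * fps_expansion c 0) + fps_X * (fps_X * fps_expansion c 0)"
  have "(\<lambda>\<zeta>. \<zeta> + 2 * \<i> * (\<zeta> * c \<zeta>) + \<zeta> * (\<zeta> * c \<zeta>)) has_fps_expansion ?R"
    by (intro has_fps_expansion_add has_fps_expansion_mult has_fps_expansion_fps_X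
        has_fps_expansion_const e)
  moreover have ev: "\<forall>\<^sub>F \<zeta> in nhds 0. c \<zeta> = \<zeta> + 2 * \<i> * (\<zeta> * c \<zeta>) + \<zeta> * (\<zeta> * c \<zeta>)"
  proof (rule eventually_nhds_in_open[THEN eventually_mono])
    fix \<zeta> :: complex assume \<zeta>: "\<zeta> \<in> ball 0 1"
    have "c \<zeta> * (1 - \<i> * \<zeta>)\<^sup>2 = \<zeta>" using nz[OF \<zeta>] by (simp add: c[OF \<zeta>])
    then show "c \<zeta> = \<zeta> + 2 * \<i> * (\<zeta> * c \<zeta>) + \<zeta> * (\<zeta> * c \<zeta>)"
      by (simp add: power2_eq_square algebra_simps)
  qed auto
  ultimately have "c has_fps_expansion ?R"
    using has_fps_expansion_cong[OF ev refl] by blast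
  then have eq: "fps_expansion c 0 = ?R"
    by (rule fps_expansion_unique_complex[OF e])
  have C0: "C 0 = 0" by (simp add: C_def fps_expansion_def c)
  have rec: "C (Suc n) = (if n = 0 then 1 else 0) + 2 * \<i> * C n + (if n = 0 then 0 else C (n - 1))" for n
    unfolding C_def by (subst eq) (simp add: fps_X_mult_nth fps_X_nth)
  have C1: "C 1 = 1" using rec[of 0] C0 by simp
  show C2: "C 2 = 2 * \<i>" using rec[of 1] C0 C1 by (simp add: numeral_2_eq_2)
  show C3: "C 3 = -3" using rec[of 2] C1 C2 by (simp add: numeral_3_eq_3)
  show "C 4 = -4 * \<i>" using rec[of 3] C2 C3 by (simp add: eval_nat_numeral)
qed

lemma starlike_map_bound_attained:
  fixes x0 :: "'a::complex_banach"
  assumes "x0 \<noteq> 0"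
  obtains f :: "'a \<Rightarrow> complex" and F :: "'a \<Rightarrow> 'a" and z l where
    "f fholomorphic_on ball 0 1" "f 0 = 1" "\<And>z. F z = f z *\<^sub>C z" "F \<in> starlike_maps"
    "z \<in> ball 0 1 - {0}" "l \<in> norming_functionals z"
    "cmod ((A2 F z l - A4 F z l) * ((A2 F z l)\<^sup>2 - 2 * (A3 F z l)\<^sup>2 + A2 F z l * A4 F z l)) = 84"
proof -
  define z where "z = (1 / (2 * norm x0)) *\<^sub>R x0"
  have z: "norm z = 1 / 2" using assms by (simp add: z_def)
  then have z0: "z \<noteq> 0" by auto
  obtain l where l: "l \<in> norming_functionals z" using norming_functionals_nonempty[OF z0] by blast
  then have lc: "bounded_clinear l" and lz: "l z = of_real (norm z)" by (auto simp: norming_functionals_def)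
  \<comment> \<open>The factor \<open>\<i>\<close> makes the k-th coefficient k i^(k-1). The first
    factor becomes 2i + 4i. In the second, \<open>A2\<close> squared turns from 4 into -4 while the
    terms of total weight four keep their value -10, and the sum is -14.\<close>
  define m where "m y = \<i> * l y" for y
  have lC: "l (c *\<^sub>C y) = c * l y" for c y
    using lc by (simp add: bounded_clinear_def scaleC_complex_def)
  have mc: "bounded_clinear m"
    using lc bounded_linear_const_mult[of l \<i>] by (auto simp: m_def[abs_def] bounded_clinear_def scaleC_complex_def)
  have m_le: "cmod (m y) \<le> norm y" for y
    using norming_functional_bound[OF l] by (simp add: m_def norm_mult)
  define F where "F y = (1 / (1 - m y)\<^sup>2) *\<^sub>C y" for y
  have F: "F \<in> starlike_maps" using koebe_lift_starlike(2)[OF mc m_le] by (simp add: F_def[abs_def])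
  then have Fhol: "F fholomorphic_on ball 0 1" by (simp add: starlike_maps_def biholomorphic_on_def)
  let ?x = "(1 / norm z) *\<^sub>R z"
  have lx: "l ?x = 1" using z0 by (simp add: scaleR_scaleC lC lz)
  have "l (F (\<zeta> *\<^sub>C ?x)) = \<zeta> / (1 - \<i> * \<zeta>)\<^sup>2" for \<zeta>
    unfolding F_def lC m_def lx by simp
  note coeffs = rotated_koebe_coeffs[OF this]
  have A: "A2 F z l = 2 * \<i>" "A3 F z l = -3" "A4 F z l = -4 * \<i>"
    unfolding A_eq_taylor_coeff[OF Fhol lc z0] by (rule coeffs)+
  have "(A2 F z l - A4 F z l) * ((A2 F z l)\<^sup>2 - 2 * (A3 F z l)\<^sup>2 + A2 F z l * A4 F z l) = -84 * \<i>"
    unfolding A by (simp add: power2_eq_square algebra_simps)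
  then have "cmod ((A2 F z l - A4 F z l) * ((A2 F z l)\<^sup>2 - 2 * (A3 F z l)\<^sup>2 + A2 F z l * A4 F z l)) = 84"
    by (simp add: norm_mult)
  moreover have "m 0 = 0" using m_le[of 0] by simp
  ultimately show ?thesis
    using that[of "\<lambda>y. 1 / (1 - m y)\<^sup>2" F z l] koebe_lift_starlike(1)[OF mc m_le] F z z0 l
    by (simp add: F_def)
qed

theorem theorem5:
  assumes "\<exists>x::'a::complex_banach. x \<noteq> 0"
  shows
    "(\<forall>(f :: 'a \<Rightarrow> complex) (F :: 'a \<Rightarrow> 'a).
        f fholomorphic_on ball 0 1 \<and> f 0 = 1 \<and> (\<forall>z\<in>ball 0 1. F z = f z *\<^sub>C z) \<and>
        F \<in> starlike_maps \<longrightarrow>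
        (\<forall>z\<in>ball 0 1 - {0}. \<forall>l\<in>norming_functionals z.
           cmod ((A2 F z l - A4 F z l) *
             ((A2 F z l)\<^sup>2 - 2 * (A3 F z l)\<^sup>2 + A2 F z l * A4 F z l)) \<le> 84)) \<and>
     (\<forall>C::real.
        (\<forall>(f :: 'a \<Rightarrow> complex) (F :: 'a \<Rightarrow> 'a).
           f fholomorphic_on ball 0 1 \<and> f 0 = 1 \<and> (\<forall>z\<in>ball 0 1. F z = f z *\<^sub>C z) \<and>
           F \<in> starlike_maps \<longrightarrow>
           (\<forall>z\<in>ball 0 1 - {0}. \<forall>l\<in>norming_functionals z.
              cmod ((A2 F z l - A4 F z l) *
                ((A2 F z l)\<^sup>2 - 2 * (A3 F z l)\<^sup>2 + A2 F z l * A4 F z l)) \<le> C)) \<longrightarrow>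
        84 \<le> C)"
proof (intro conjI allI impI ballI)
  fix f :: "'a \<Rightarrow> complex" and F and z :: 'a and l
  assume "f fholomorphic_on ball 0 1 \<and> f 0 = 1 \<and> (\<forall>z\<in>ball 0 1. F z = f z *\<^sub>C z) \<and> F \<in> starlike_maps"
    and "z \<in> ball 0 1 - {0}" "l \<in> norming_functionals z"
  then show "cmod ((A2 F z l - A4 F z l) *
      ((A2 F z l)\<^sup>2 - 2 * (A3 F z l)\<^sup>2 + A2 F z l * A4 F z l)) \<le> 84"
    by (intro starlike_map_bound[where f = f]) auto
next
  fix C :: real
  assume C: "\<forall>(f :: 'a \<Rightarrow> complex) (F :: 'a \<Rightarrow> 'a).
     f fholomorphic_on ball 0 1 \<and> f 0 = 1 \<and> (\<forall>z\<in>ball 0 1. F z = f z *\<^sub>C z) \<and> F \<in> starlike_maps \<longrightarrow>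
     (\<forall>z\<in>ball 0 1 - {0}. \<forall>l\<in>norming_functionals z.
        cmod ((A2 F z l - A4 F z l) * ((A2 F z l)\<^sup>2 - 2 * (A3 F z l)\<^sup>2 + A2 F z l * A4 F z l)) \<le> C)"
  obtain x0 :: 'a where "x0 \<noteq> 0" using assms by blast
  then obtain f :: "'a \<Rightarrow> complex" and F and z :: 'a and l where
    "f fholomorphic_on ball 0 1" "f 0 = 1" "\<And>z. F z = f z *\<^sub>C z" "F \<in> starlike_maps"
    "z \<in> ball 0 1 - {0}" "l \<in> norming_functionals z"
    "cmod ((A2 F z l - A4 F z l) * ((A2 F z l)\<^sup>2 - 2 * (A3 F z l)\<^sup>2 + A2 F z l * A4 F z l)) = 84"
    by (rule starlike_map_bound_attained) (rule that)
  with C show "84 \<le> C" by metis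
qed

end
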